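(* Let $\mathbb{F}$ be $\mathbb{R}$ or $\mathbb{C}$, and let $\bm{\xi}^{(1)},\ldots,\bm{\xi}^{(\mu)},\bm{\xi}^{(\mu+1)},\ldots,\bm{\xi}^{(\mu+\nu)}\in\mathbb{F}^d$ be distinct points. For each $1\le k\le\mu$ let $\Delta^{(k)}\subset\mathbb{N}^d$ be a finite lower set and let $\bm{\rho}^{(k)}=(\bm{\rho}^{(k)}_1,\ldots,\bm{\rho}^{(k)}_d)\in(\mathbb{F}^d)^d$ be a tuple of $\mathbb{F}$-linearly independent unit vectors. For each $1\le l\le\nu$ let $n(l)\ge 1$, let $\bm{a}^{(l)}=(a^{(l)}_0,a^{(l)}_1,\ldots,a^{(l)}_{n(l)})$ be a tuple of positive integers with $a^{(l)}_0=1$ and $a^{(l)}_1>\cdots>a^{(l)}_{n(l)}\ge 2$, and let $\bm{c}^{(l)}_i=(c^{(l)}_{i,0},\ldots,c^{(l)}_{i,n(l)})\in\mathbb{F}^{n(l)+1}$, $1\le i\le d$, be such that $c^{(l)}_{1,0},\ldots,c^{(l)}_{d,0}$ are not all zero. For $0\le m\le a_1^{(l)}$ let $$q^{(l)}_{n(l),m}=\sum\frac{(\bm{c}^{(l)}_1)^{\bm{\gamma}_1}\cdots(\bm{c}^{(l)}_d)^{\bm{\gamma}_d}}{\bm{\gamma}_1!\cdots\bm{\gamma}_d!}\,x_1^{\|\bm{\gamma}_1\|_1}\cdots x_d^{\|\bm{\gamma}_d\|_1},$$ where the sum runs over all $(\bm{\gamma}_1,\ldots,\bm{\gamma}_d)\in(\mathbb{N}^{n(l)+1})^d$,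 $\bm{\gamma}_i=(\gamma_{i,0},\ldots,\gamma_{i,n(l)})$, with $\sum_{j=0}^{n(l)}a^{(l)}_j\sum_{i=1}^d\gamma_{i,j}=m$. Let $P$ be an ideal projector on $\mathbb{F}[\bm{x}]=\mathbb{F}[x_1,\ldots,x_d]$ with $$\mathrm{ran}\,P'=\mathrm{span}_{\mathbb{F}}\big\{\delta_{\bm{\xi}^{(k)}}D^{\bm{\alpha}}_{\bm{\rho}^{(k)}},\ \delta_{\bm{\xi}^{(\mu+l)}}q^{(l)}_{n(l),m}(D):\ \bm{\alpha}\in\Delta^{(k)},\,1\le k\le\mu,\ 0\le m\le a^{(l)}_1,\,1\le l\le\nu\big\},$$ and let $P_h$ be a Lagrange projector with $$\mathrm{ran}\,P_h'=\mathrm{span}_{\mathbb{F}}\big\{\delta_{\bm{\xi}^{(k)}+h\sum_{i=1}^d\alpha_i\bm{\rho}^{(k)}_i},\ \delta_{\bm{\xi}^{(\mu+l)}+\bm{\phi}^{(l)}(mh)}:\ \bm{\alpha}\in\Delta^{(k)},\,1\le k\le\mu,\ 0\le m\le a^{(l)}_1,\,1\le l\le\nu\big\},$$ where $h\in\mathbb{F}\setminus\{0\}$ and $$\bm{\phi}^{(l)}(mh)=\Big(\sum_{j=0}^{n(l)}c^{(l)}_{1,j}(mh)^{a^{(l)}_j},\ \sum_{j=0}^{n(l)}c^{(l)}_{2,j}(mh)^{a^{(l)}_j},\ \ldots,\ \sum_{j=0}^{n(l)}c^{(l)}_{d,j}(mh)^{a^{(l)}_j}\Big).$$ Then the following statements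 hold: (i) There exists a positive $\eta\in\mathbb{F}$ such that $\mathrm{ran}\,P_h=\mathrm{ran}\,P$ for all $0<|h|<\eta$. (ii) $P$ is the pointwise limit of $P_h$, $0<|h|<\eta$, as $h$ tends to zero.
   Context: $\mathbb{N}$ is the set of nonnegative integers. A set $\Delta\subset\mathbb{N}^d$ is a lower set if $\bm{\alpha}\in\Delta$ and $\bm{\beta}\le\bm{\alpha}$ (componentwise) imply $\bm{\beta}\in\Delta$. For a tuple $\bm{\gamma}=(\gamma_0,\ldots,\gamma_n)$ of nonnegative integers, $\|\bm{\gamma}\|_1=\sum_j\gamma_j$, $\bm{\gamma}!=\prod_j\gamma_j!$, and $\bm{c}^{\bm{\gamma}}=\prod_j c_j^{\gamma_j}$ (with $0^0=1$). An ideal projector on $\mathbb{F}[\bm{x}]$ is a linear idempotent operator $P:\mathbb{F}[\bm{x}]\to\mathbb{F}[\bm{x}]$ (here of finite rank) whose kernel is an ideal. $P$ is a Lagrange projector if its kernel is the ideal of all polynomials vanishing on some finite set $\Xi\subset\mathbb{F}^d$. $\mathrm{ran}\,P=P(\mathbb{F}[\bm{x}])$ is the range of $P$. $P'$ denotes the dual projector on the algebraic dual $\mathbb{F}[\bm{x}]'$, and $\mathrm{ran}\,P'=(\ker P)^{\perp}=\{\lambda\in\mathbb{F}[\bm{x}]':\ker P\subset\ker\lambda\}$ is the set of interpolation conditions matched by $P$. $\delta_{\bm{\xi}}$ is the evaluation functional $f\mapsto f(\bm{\xi})$. For a polynomial $p=\sum_{\bm{\alpha}}\widehat p(\bm{\alpha})\bm{x}^{\bm{\alpha}}$,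 $p(D)$ is the differential operator $f\mapsto\sum_{\bm{\alpha}}\widehat p(\bm{\alpha})\,\partial^{\|\bm{\alpha}\|_1}f/\partial x_1^{\alpha_1}\cdots\partial x_d^{\alpha_d}$. For $\bm{\rho}=(\bm{\rho}_1,\ldots,\bm{\rho}_d)$ with $\bm{\rho}_i=(\rho_{i,1},\ldots,\rho_{i,d})$, $D^{\bm{\alpha}}_{\bm{\rho}}f=\partial^{\|\bm{\alpha}\|_1}f/\partial\bm{\rho}_1^{\alpha_1}\cdots\partial\bm{\rho}_d^{\alpha_d}$, where $\partial/\partial\bm{\rho}_i=\sum_{j=1}^d\rho_{i,j}\,\partial/\partial x_j$ is the directional derivative. Composites such as $\delta_{\bm{\xi}}q(D)$ denote the functional $f\mapsto(q(D)f)(\bm{\xi})$. That $P$ is the pointwise limit of $P_h$ means that for every $f\in\mathbb{F}[\bm{x}]$, $P_hf$ converges to $Pf$ coefficientwise as $h\to0$.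
   Formalization: ran P_h' alone does not determine ran P_h, so (i) fails for arbitrary P_h; proved instead: for 0<|h|<η a Lagrange projector with the given ran P_h' and ran P_h = ran P exists, and (ii) holds for every family P_h of such projectors. *)

theory Defs
  imports "HOL-Analysis.Analysis" "HOL-Library.Poly_Mapping" "HOL-Library.Function_Algebras"
begin

text \<open>
  The scalars range over the class \<^class>\<open>real_normed_field\<close>. Both \<^typ>\<open>real\<close> and \<^typ>\<open>complex\<close> are
  instances, and by the Gelfand-Mazur theorem they are the only ones up to isometric isomorphism.
  The index type \<open>'d\<close> plays the role of \<open>{1..d}\<close>.
\<close>

type_synonym ('a, 'd) mpoly = "(nat ^ 'd) \<Rightarrow>\<^sub>0 'a"

definition is_lower_set :: "(nat ^ 'd) set \<Rightarrow> bool" where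
  "is_lower_set \<Delta> \<longleftrightarrow> (\<forall>\<alpha>\<in>\<Delta>. \<forall>\<beta>\<le>\<alpha>. \<beta> \<in> \<Delta>)"

definition eval_poly :: "('a::comm_semiring_1, 'd::finite) mpoly \<Rightarrow> 'a ^ 'd \<Rightarrow> 'a" where
  "eval_poly p x = (\<Sum>\<alpha>\<in>Poly_Mapping.keys p. Poly_Mapping.lookup p \<alpha> * (\<Prod>i\<in>UNIV. (x $ i) ^ (\<alpha> $ i)))"

definition poly_scale :: "'a::comm_semiring_1 \<Rightarrow> ('a, 'd::finite) mpoly \<Rightarrow> ('a, 'd) mpoly" where
  "poly_scale c p = Poly_Mapping.map ((*) c) p"

lemma lookup_poly_scale [simp]:
  "Poly_Mapping.lookup (poly_scale c p) \<alpha> = c * Poly_Mapping.lookup p \<alpha>"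
  by (simp add: poly_scale_def map.rep_eq when_def)

global_interpretation mpoly: vector_space "poly_scale :: 'a::field \<Rightarrow> ('a, 'd::finite) mpoly \<Rightarrow> _"
  by unfold_locales (auto intro!: poly_mapping_eqI simp: lookup_add algebra_simps)


subsection \<open>Differential operators\<close>

text \<open>In \<open>partial_deriv\<close>, the truncated difference \<open>\<alpha> - axis i 1\<close> at \<open>\<alpha> $ i = 0\<close> is harmless because
  the coefficient vanishes.\<close>

definition partial_deriv :: "'d \<Rightarrow> ('a::comm_semiring_1, 'd::finite) mpoly \<Rightarrow> ('a, 'd) mpoly" where
  "partial_deriv i p = (\<Sum>\<alpha>\<in>Poly_Mapping.keys p.
     Poly_Mapping.single (\<alpha> - axis i 1) (of_nat (\<alpha> $ i) * Poly_Mapping.lookup p \<alpha>))"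

definition dir_deriv :: "'a::comm_semiring_1 ^ 'd \<Rightarrow> ('a, 'd::finite) mpoly \<Rightarrow> ('a, 'd) mpoly" where
  "dir_deriv v p = (\<Sum>j\<in>UNIV. poly_scale (v $ j) (partial_deriv j p))"

text \<open>\<open>iter_deriv E \<alpha>\<close> composes the powers \<open>E i ^^ (\<alpha> $ i)\<close> over all \<open>i\<close>. The order is immaterial
  for commuting operators; see \<open>partial_deriv_comp_fun_commute\<close> and
  \<open>dir_deriv_comp_fun_commute\<close> below.\<close>

definition iter_deriv ::
    "('d \<Rightarrow> ('a::comm_semiring_1, 'd::finite) mpoly \<Rightarrow> ('a, 'd) mpoly) \<Rightarrow> nat ^ 'd
      \<Rightarrow> ('a, 'd) mpoly \<Rightarrow> ('a, 'd) mpoly" where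
  "iter_deriv E \<alpha> p = Finite_Set.fold (\<lambda>i. E i ^^ (\<alpha> $ i)) p UNIV"

definition diff_op :: "('a::comm_semiring_1, 'd::finite) mpoly \<Rightarrow> ('a, 'd) mpoly \<Rightarrow> ('a, 'd) mpoly" where
  "diff_op q f = (\<Sum>\<alpha>\<in>Poly_Mapping.keys q.
     poly_scale (Poly_Mapping.lookup q \<alpha>) (iter_deriv partial_deriv \<alpha> f))"

lemma lookup_partial_deriv:
  "Poly_Mapping.lookup (partial_deriv i p) \<beta> =
     of_nat (\<beta> $ i + 1) * Poly_Mapping.lookup p (\<beta> + axis i 1)"
proof -
  let ?t = "\<lambda>\<alpha>. (of_nat (\<alpha> $ i) * Poly_Mapping.lookup p \<alpha> when \<alpha> - axis i 1 = \<beta>)"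
  have t: "?t \<alpha> = 0" if "\<alpha> \<noteq> \<beta> + axis i 1" for \<alpha>
  proof (cases "\<alpha> $ i = 0")
    case False
    have "\<alpha> - axis i 1 \<noteq> \<beta>"
    proof
      assume "\<alpha> - axis i 1 = \<beta>"
      moreover have "\<alpha> = (\<alpha> - axis i 1) + axis i 1"
        using False by (auto simp: vec_eq_iff axis_def)
      ultimately show False using that by simp
    qed
    then show ?thesis by simp
  qed simp
  have "Poly_Mapping.lookup (partial_deriv i p) \<beta> = (\<Sum>\<alpha>\<in>Poly_Mapping.keys p. ?t \<alpha>)"
    by (simp add: partial_deriv_def lookup_sum lookup_single)
  also have "\<dots> = (\<Sum>\<alpha>\<in>insert (\<beta> + axis i 1) (Poly_Mapping.keys p). ?t \<alpha>)"
    by (intro sum.mono_neutral_left) (auto simp: in_keys_iff)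
  also have "\<dots> = (\<Sum>\<alpha>\<in>{\<beta> + axis i 1}. ?t \<alpha>)"
    using t by (intro sum.mono_neutral_right) auto
  also have "\<dots> = of_nat (\<beta> $ i + 1) * Poly_Mapping.lookup p (\<beta> + axis i 1)"
    by (simp add: axis_def)
  finally show ?thesis .
qed

lemma partial_deriv_commute:
  "partial_deriv i (partial_deriv j p) = partial_deriv j (partial_deriv i p)"
  by (rule poly_mapping_eqI, cases "i = j")
     (simp_all add: lookup_partial_deriv axis_def algebra_simps)

lemma lookup_dir_deriv:
  "Poly_Mapping.lookup (dir_deriv v p) \<beta> =
     (\<Sum>j\<in>UNIV. v $ j * Poly_Mapping.lookup (partial_deriv j p) \<beta>)"
  by (simp add: dir_deriv_def lookup_sum)

lemma dir_deriv_commute: "dir_deriv v (dir_deriv w p) = dir_deriv w (dir_deriv v p)"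
proof (rule poly_mapping_eqI)
  fix \<beta>
  have expand: "Poly_Mapping.lookup (dir_deriv v (dir_deriv w p)) \<beta> =
      (\<Sum>j\<in>UNIV. \<Sum>k\<in>UNIV. v $ j * w $ k *
         Poly_Mapping.lookup (partial_deriv j (partial_deriv k p)) \<beta>)" for v w
    by (simp add: lookup_dir_deriv lookup_partial_deriv sum_distrib_left algebra_simps)
  show "Poly_Mapping.lookup (dir_deriv v (dir_deriv w p)) \<beta> =
        Poly_Mapping.lookup (dir_deriv w (dir_deriv v p)) \<beta>"
    unfolding expand
    by (subst sum.swap) (simp add: partial_deriv_commute mult.commute)
qed

lemma partial_deriv_comp_fun_commute: "comp_fun_commute (\<lambda>i. partial_deriv i ^^ (\<alpha> $ i))"
proof -
  interpret comp_fun_commute partial_deriv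
    by unfold_locales (simp add: fun_eq_iff partial_deriv_commute)
  show ?thesis by (rule comp_fun_commute_funpow)
qed

lemma dir_deriv_comp_fun_commute: "comp_fun_commute (\<lambda>i. dir_deriv (\<rho> i) ^^ (\<alpha> $ i))"
proof -
  interpret comp_fun_commute "\<lambda>i. dir_deriv (\<rho> i)"
    by unfold_locales (simp add: fun_eq_iff dir_deriv_commute)
  show ?thesis by (rule comp_fun_commute_funpow)
qed


subsection \<open>Ideal projectors\<close>

definition is_poly_ideal :: "('a::comm_ring_1, 'd::finite) mpoly set \<Rightarrow> bool" where
  "is_poly_ideal I \<longleftrightarrow> 0 \<in> I \<and> (\<forall>p\<in>I. \<forall>q\<in>I. p + q \<in> I) \<and> (\<forall>p\<in>I. \<forall>r. r * p \<in> I)"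

definition poly_kernel :: "(('a::zero, 'd) mpoly \<Rightarrow> ('a, 'd) mpoly) \<Rightarrow> ('a, 'd) mpoly set" where
  "poly_kernel P = {p. P p = 0}"

definition ideal_projector :: "(('a::field, 'd::finite) mpoly \<Rightarrow> ('a, 'd) mpoly) \<Rightarrow> bool" where
  "ideal_projector P \<longleftrightarrow>
     Vector_Spaces.linear poly_scale poly_scale P \<and> P \<circ> P = P \<and>
     (\<exists>B. finite B \<and> range P \<subseteq> mpoly.span B) \<and>
     is_poly_ideal (poly_kernel P)"

definition lagrange_projector :: "(('a::field, 'd::finite) mpoly \<Rightarrow> ('a, 'd) mpoly) \<Rightarrow> bool" where
  "lagrange_projector P \<longleftrightarrow> ideal_projector P \<and>
     (\<exists>\<Xi>. finite \<Xi> \<and> poly_kernel P = {p. \<forall>x\<in>\<Xi>. eval_poly p x = 0})"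

definition functional_scale :: "'a::field \<Rightarrow> (('a, 'd::finite) mpoly \<Rightarrow> 'a) \<Rightarrow> ('a, 'd) mpoly \<Rightarrow> 'a" where
  "functional_scale c \<phi> = (\<lambda>p. c * \<phi> p)"

global_interpretation functional: vector_space
    "functional_scale :: 'a::field \<Rightarrow> (('a, 'd::finite) mpoly \<Rightarrow> 'a) \<Rightarrow> _"
  by unfold_locales (auto simp: functional_scale_def fun_eq_iff algebra_simps)

definition algebraic_dual :: "(('a::field, 'd::finite) mpoly \<Rightarrow> 'a) set" where
  "algebraic_dual = {\<phi>. Vector_Spaces.linear poly_scale (*) \<phi>}"

definition dual_projector ::
    "(('a::field, 'd::finite) mpoly \<Rightarrow> ('a, 'd) mpoly) \<Rightarrow> (('a, 'd) mpoly \<Rightarrow> 'a) \<Rightarrow> ('a, 'd) mpoly \<Rightarrow> 'a" where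
  "dual_projector P \<phi> = \<phi> \<circ> P"

definition dual_range ::
    "(('a::field, 'd::finite) mpoly \<Rightarrow> ('a, 'd) mpoly) \<Rightarrow> (('a, 'd) mpoly \<Rightarrow> 'a) set" where
  "dual_range P = dual_projector P ` algebraic_dual"

lemma linear_lookup_in_dual: "(\<lambda>p. Poly_Mapping.lookup p \<beta>) \<in> algebraic_dual"
  unfolding algebraic_dual_def
  by (auto intro!: Vector_Spaces.linear.intro module_hom.intro module_hom_axioms.intro
        mpoly.vector_space_axioms mpoly.module_axioms vector_space_over_itself.vector_space_axioms
        vector_space_over_itself.module_axioms simp: lookup_add)

lemma dual_range_eq_annihilator:
  assumes "ideal_projector P"
  shows "dual_range P = {\<phi> \<in> algebraic_dual. \<forall>p\<in>poly_kernel P. \<phi> p = 0}"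
proof -
  have P: "Vector_Spaces.linear poly_scale poly_scale P" and PP: "P (P p) = P p" for p
    using assms by (auto simp: ideal_projector_def fun_eq_iff)
  interpret P: Vector_Spaces.linear poly_scale poly_scale P by (fact P)
  show ?thesis
  proof (intro equalityI subsetI)
    fix \<psi> assume "\<psi> \<in> dual_range P"
    then obtain \<phi> where \<phi>: "Vector_Spaces.linear poly_scale (*) \<phi>" and \<psi>: "\<psi> = \<phi> \<circ> P"
      by (auto simp: dual_range_def dual_projector_def algebraic_dual_def)
    interpret \<phi>: Vector_Spaces.linear poly_scale "(*)" \<phi> by (fact \<phi>)
    have "\<psi> \<in> algebraic_dual"
      unfolding \<psi> algebraic_dual_def using Vector_Spaces.linear_compose[OF P \<phi>] by simp
    then show "\<psi> \<in> {\<phi> \<in> algebraic_dual. \<forall>p\<in>poly_kernel P. \<phi> p = 0}"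
      by (simp add: \<psi> poly_kernel_def \<phi>.zero)
  next
    fix \<psi> assume "\<psi> \<in> {\<phi> \<in> algebraic_dual. \<forall>p\<in>poly_kernel P. \<phi> p = 0}"
    then have \<psi>: "\<psi> \<in> algebraic_dual" and ker: "\<And>p. P p = 0 \<Longrightarrow> \<psi> p = 0"
      by (auto simp: poly_kernel_def)
    interpret \<psi>: Vector_Spaces.linear poly_scale "(*)" \<psi> using \<psi> by (simp add: algebraic_dual_def)
    have "\<psi> p = \<psi> (P p)" for p
      using ker[of "p - P p"] by (simp add: P.diff PP \<psi>.diff)
    then have "\<psi> = dual_projector P \<psi>" by (auto simp: dual_projector_def)
    then show "\<psi> \<in> dual_range P" using \<psi> by (auto simp: dual_range_def)
  qed
qed

lemma poly_kernel_eq_dual_range: "poly_kernel P = {p. \<forall>\<phi>\<in>dual_range P. \<phi> p = 0}"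
proof (intro equalityI subsetI)
  fix p assume "p \<in> poly_kernel P"
  then have p: "P p = 0" by (simp add: poly_kernel_def)
  have "\<phi> 0 = 0" if "\<phi> \<in> algebraic_dual" for \<phi>
  proof -
    interpret \<phi>: Vector_Spaces.linear poly_scale "(*)" \<phi> using that by (simp add: algebraic_dual_def)
    show ?thesis by (rule \<phi>.zero)
  qed
  then show "p \<in> {p. \<forall>\<phi>\<in>dual_range P. \<phi> p = 0}"
    by (auto simp: p dual_range_def dual_projector_def)
next
  fix p assume *: "p \<in> {p. \<forall>\<phi>\<in>dual_range P. \<phi> p = 0}"
  have "Poly_Mapping.lookup (P p) \<beta> = 0" for \<beta>
    using * linear_lookup_in_dual[of \<beta>] by (force simp: dual_range_def dual_projector_def)
  then show "p \<in> poly_kernel P" by (auto simp: poly_kernel_def intro: poly_mapping_eqI)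
qed

text \<open>An ideal projector is determined by its range together with its interpolation conditions.
  The interpolation conditions alone do not determine the range.\<close>

lemma ideal_projector_eqI:
  assumes "ideal_projector P" "ideal_projector Q" "range P = range Q" "dual_range P = dual_range Q"
  shows "P = Q"
proof
  fix p
  have "poly_kernel P = poly_kernel Q"
    using poly_kernel_eq_dual_range[of P] poly_kernel_eq_dual_range[of Q] assms(4) by simp
  then have ker: "P r = 0 \<longleftrightarrow> Q r = 0" for r by (auto simp: poly_kernel_def)
  interpret P: Vector_Spaces.linear poly_scale poly_scale P
    using assms by (simp add: ideal_projector_def)
  interpret Q: Vector_Spaces.linear poly_scale poly_scale Q
    using assms by (simp add: ideal_projector_def)
  have PP: "P (P r) = P r" and QQ: "Q (Q r) = Q r" for r
    using assms by (auto simp: ideal_projector_def fun_eq_iff)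
  obtain r where r: "P p = Q r" using assms(3) by (metis rangeE rangeI)
  have "Q (p - P p) = 0" using ker[of "p - P p"] by (simp add: P.diff PP)
  then show "P p = Q p" by (simp add: Q.diff r QQ)
qed


subsection \<open>The curves and the associated polynomials\<close>

text \<open>The tuple \<open>\<gamma> = (\<gamma>\<^sub>1, \<dots>, \<gamma>\<^sub>d)\<close> with \<open>\<gamma>\<^sub>i = (\<gamma>\<^sub>i\<^sub>0, \<dots>, \<gamma>\<^sub>i\<^sub>n)\<close> is encoded as a function that vanishes
  for second index beyond \<open>n\<close>, so that each tuple is represented exactly once.\<close>

definition weighted_tuples :: "nat \<Rightarrow> (nat \<Rightarrow> nat) \<Rightarrow> nat \<Rightarrow> ('d::finite \<Rightarrow> nat \<Rightarrow> nat) set" where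
  "weighted_tuples n a m =
     {\<gamma>. (\<forall>i. \<forall>j>n. \<gamma> i j = 0) \<and> (\<Sum>j=0..n. a j * (\<Sum>i\<in>UNIV. \<gamma> i j)) = m}"

definition curve_poly ::
    "nat \<Rightarrow> (nat \<Rightarrow> nat) \<Rightarrow> ('d \<Rightarrow> nat \<Rightarrow> 'a) \<Rightarrow> nat \<Rightarrow> ('a::field_char_0, 'd::finite) mpoly" where
  "curve_poly n a c m = (\<Sum>\<gamma>\<in>weighted_tuples n a m.
     Poly_Mapping.single (\<chi> i. \<Sum>j=0..n. \<gamma> i j)
       ((\<Prod>i\<in>UNIV. \<Prod>j=0..n. c i j ^ \<gamma> i j) / (\<Prod>i\<in>UNIV. \<Prod>j=0..n. fact (\<gamma> i j))))"

definition curve ::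
    "nat \<Rightarrow> (nat \<Rightarrow> nat) \<Rightarrow> ('d \<Rightarrow> nat \<Rightarrow> 'a) \<Rightarrow> 'a \<Rightarrow> 'a::comm_semiring_1 ^ 'd::finite" where
  "curve n a c t = (\<chi> i. \<Sum>j=0..n. c i j * t ^ a j)"

text \<open>For positive weights the sum in \<open>curve_poly\<close> is finite, hence not junk.\<close>

lemma finite_weighted_tuples:
  assumes "\<And>j. j \<le> n \<Longrightarrow> 0 < a j"
  shows "finite (weighted_tuples n a m :: ('d::finite \<Rightarrow> nat \<Rightarrow> nat) set)"
proof (rule finite_subset)
  let ?G = "{g :: nat \<Rightarrow> nat. \<forall>j. (j \<in> {0..n} \<longrightarrow> g j \<in> {0..m}) \<and> (j \<notin> {0..n} \<longrightarrow> g j = 0)}"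
  have "finite ?G" by (rule finite_set_of_finite_funs) auto
  then show "finite (Pi\<^sub>E (UNIV :: 'd set) (\<lambda>_. ?G))" by (intro finite_PiE) auto
  show "weighted_tuples n a m \<subseteq> Pi\<^sub>E (UNIV :: 'd set) (\<lambda>_. ?G)"
  proof
    fix \<gamma> :: "'d \<Rightarrow> nat \<Rightarrow> nat" assume \<gamma>: "\<gamma> \<in> weighted_tuples n a m"
    have "\<gamma> i j \<le> m" if "j \<le> n" for i j
    proof -
      have "\<gamma> i j \<le> (\<Sum>i\<in>UNIV. \<gamma> i j)" by (rule member_le_sum) auto
      also have "\<dots> \<le> a j * (\<Sum>i\<in>UNIV. \<gamma> i j)" using assms[OF that] by simp
      also have "\<dots> \<le> (\<Sum>j=0..n. a j * (\<Sum>i\<in>UNIV. \<gamma> i j))"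
        using that by (intro member_le_sum[of j "{0..n}" "\<lambda>j. a j * (\<Sum>i\<in>UNIV. \<gamma> i j)"]) auto
      finally show ?thesis using \<gamma> by (simp add: weighted_tuples_def)
    qed
    then show "\<gamma> \<in> Pi\<^sub>E UNIV (\<lambda>_. ?G)" using \<gamma> by (auto simp: weighted_tuples_def PiE_def)
  qed
qed

end

theory Submission
  imports Defs
begin

text \<open>
  Taylor expansion along several directions shows that each interpolation condition of \<open>P\<close> is the
  limit, as \<open>h\<close> tends to \<open>0\<close>, of a scaled finite difference of the point evaluations that span
  \<open>ran P\<^sub>h'\<close>: the lower set property keeps the nodes of the differences for \<open>D\<^sub>\<rho>\<^sup>\<alpha>\<close> inside the grid,
  and \<open>q\<^sub>m\<close> is the coefficient of \<open>t\<^sup>m\<close> in the formal exponential of the curve \<open>\<phi>(t)\<close>, so that \<open>q\<^sub>m(D)\<close>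
  is picked out by the \<open>m\<close>-th difference along the curve.
  The same limits, taken on products of a homogeneous polynomial at one point with high powers of
  linear polynomials vanishing at the other points, show that the conditions are linearly independent.
  So \<open>ran P\<close> has a basis dual to them, on which the scaled differences form a matrix close to the
  identity. It is invertible for small \<open>h\<close>, which makes interpolation from \<open>ran P\<close> at the perturbed
  points uniquely solvable, with solutions converging to those for \<open>P\<close>.
\<close>

subsection \<open>Finite differences\<close>

definition diff_coeff :: "nat \<Rightarrow> nat \<Rightarrow> 'a::comm_ring_1" where
  "diff_coeff m s = (-1) ^ (m - s) * of_nat (m choose s)"

lemma sum_diff_coeff_power_Suc:
  "(\<Sum>s\<le>Suc m. diff_coeff (Suc m) s * of_nat s ^ Suc r) =
     (of_nat (Suc m) * (\<Sum>q\<le>r. of_nat (r choose q) * (\<Sum>s\<le>m. diff_coeff m s * of_nat s ^ q)) :: 'a::comm_ring_1)"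
proof -
  have term_eq: "diff_coeff (Suc m) (Suc s) * (of_nat (Suc s) :: 'a) ^ Suc r =
      of_nat (Suc m) * (diff_coeff m s * (of_nat s + 1) ^ r)" for s
  proof -
    have "diff_coeff (Suc m) (Suc s) * (of_nat (Suc s) :: 'a) ^ Suc r =
        (-1) ^ (m - s) * of_nat ((Suc m choose Suc s) * Suc s) * of_nat (Suc s) ^ r"
      by (simp only: diff_coeff_def of_nat_mult power_Suc diff_Suc_Suc mult_ac)
    also have "(Suc m choose Suc s) * Suc s = Suc m * (m choose s)"
      using Suc_times_binomial_eq[of m s] by simp
    finally show ?thesis
      by (simp add: diff_coeff_def algebra_simps)
  qed
  have "(\<Sum>s\<le>Suc m. diff_coeff (Suc m) s * (of_nat s :: 'a) ^ Suc r) =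
      (\<Sum>s\<le>m. of_nat (Suc m) * (diff_coeff m s * (of_nat s + 1) ^ r))"
    by (subst sum.atMost_Suc_shift) (simp add: term_eq del: of_nat_Suc power_Suc)
  also have "\<dots> = of_nat (Suc m) * (\<Sum>s\<le>m. \<Sum>q\<le>r. of_nat (r choose q) * (diff_coeff m s * of_nat s ^ q))"
  proof -
    have "(of_nat s + 1 :: 'a) ^ r = (\<Sum>q\<le>r. of_nat (r choose q) * of_nat s ^ q)" for s
      by (subst binomial_ring) simp
    then show ?thesis by (simp add: sum_distrib_left mult_ac del: of_nat_Suc)
  qed
  also have "\<dots> = of_nat (Suc m) * (\<Sum>q\<le>r. of_nat (r choose q) * (\<Sum>s\<le>m. diff_coeff m s * of_nat s ^ q))"
    by (subst sum.swap) (simp add: sum_distrib_left)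
  finally show ?thesis .
qed

lemma sum_diff_coeff_power:
  "r \<le> m \<Longrightarrow> (\<Sum>s\<le>m. diff_coeff m s * of_nat s ^ r) = (if r = m then fact m else (0::'a::{comm_ring_1,semiring_char_0}))"
proof (induction m arbitrary: r)
  case 0
  then show ?case by (simp add: diff_coeff_def)
next
  case (Suc m)
  show ?case
  proof (cases r)
    case 0
    have "(\<Sum>s\<le>Suc m. diff_coeff (Suc m) s) = (\<Sum>s\<le>Suc m. (-1) ^ Suc m * ((-1) ^ s * (of_nat (Suc m choose s) :: 'a)))"
    proof (intro sum.cong refl)
      fix s assume "s \<in> {..Suc m}"
      then have "even (Suc m - s) \<longleftrightarrow> even (Suc m + s)" by simp
      then have "(-1 :: 'a) ^ (Suc m - s) = (-1) ^ (Suc m + s)"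
        by (simp add: minus_one_power_iff)
      then show "diff_coeff (Suc m) s = (-1) ^ Suc m * ((-1) ^ s * (of_nat (Suc m choose s) :: 'a))"
        by (simp only: diff_coeff_def power_add mult.assoc)
    qed
    also have "\<dots> = 0"
      by (simp add: choose_alternating_sum flip: sum_distrib_left del: sum.atMost_Suc binomial_Suc_Suc power_Suc)
    finally show ?thesis using 0 by simp
  next
    case (Suc r')
    have r': "r' \<le> m" using Suc.prems Suc by simp
    have "(\<Sum>q\<le>r'. of_nat (r' choose q) * (\<Sum>s\<le>m. diff_coeff m s * of_nat s ^ q)) =
       (\<Sum>q\<le>r'. of_nat (r' choose q) * (if q = m then fact m else (0::'a)))"
      using r' by (intro sum.cong refl) (simp add: Suc.IH)
    also have "\<dots> = (if r' = m then fact m else 0)"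
    proof (cases "r' = m")
      case True
      then show ?thesis by (simp add: mult_delta_right)
    next
      case False
      then show ?thesis using r' by (intro trans[OF sum.neutral]) auto
    qed
    finally show ?thesis
      unfolding Suc sum_diff_coeff_power_Suc by (simp add: fact_Suc del: of_nat_Suc)
  qed
qed

lemma diff_quotient_power_tendsto:
  "((\<lambda>h::'a::real_normed_field. (\<Sum>s\<le>m. diff_coeff m s * (of_nat s * h) ^ r) / h ^ m)
     \<longlongrightarrow> (if r = m then fact m else 0)) (at 0)"
proof -
  have eq: "(\<Sum>s\<le>m. diff_coeff m s * (of_nat s * h) ^ r) / h ^ m =
      (if r = m then fact m else if r < m then 0
       else (\<Sum>s\<le>m. diff_coeff m s * of_nat s ^ r) * h ^ (r - m))" if "h \<noteq> 0" for h :: 'a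
  proof -
    have "(\<Sum>s\<le>m. diff_coeff m s * (of_nat s * h) ^ r) =
        (\<Sum>s\<le>m. diff_coeff m s * of_nat s ^ r) * h ^ r"
      by (simp add: power_mult_distrib sum_distrib_left mult_ac)
    then have "(\<Sum>s\<le>m. diff_coeff m s * (of_nat s * h) ^ r) / h ^ m =
        (\<Sum>s\<le>m. diff_coeff m s * of_nat s ^ r) * (h ^ r / h ^ m)"
      by simp
    then show ?thesis using that by (auto simp: sum_diff_coeff_power power_diff)
  qed
  have "((\<lambda>h::'a. if r = m then fact m else if r < m then 0
       else (\<Sum>s\<le>m. diff_coeff m s * of_nat s ^ r) * h ^ (r - m)) \<longlongrightarrow> (if r = m then fact m else 0)) (at 0)"
    by (cases r m rule: linorder_cases) (auto intro!: tendsto_eq_intros)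
  then show ?thesis
    by (rule Lim_transform_eventually) (auto simp: eventually_at_filter eq)
qed


subsection \<open>Evaluation and differentiation of polynomials\<close>

lemma eval_poly_superset:
  assumes "finite K" "Poly_Mapping.keys p \<subseteq> K"
  shows "eval_poly p x = (\<Sum>\<alpha>\<in>K. Poly_Mapping.lookup p \<alpha> * (\<Prod>i\<in>UNIV. (x $ i) ^ (\<alpha> $ i)))"
  unfolding eval_poly_def
  by (rule sum.mono_neutral_left) (use assms in \<open>auto simp: in_keys_iff\<close>)

lemma eval_poly_zero [simp]: "eval_poly 0 x = 0"
  by (simp add: eval_poly_def)

lemma eval_poly_single [simp]:
  "eval_poly (Poly_Mapping.single \<alpha> c) x = c * (\<Prod>i\<in>UNIV. (x $ i) ^ (\<alpha> $ i))"
  by (subst eval_poly_superset[of "{\<alpha>}"]) auto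

lemma eval_poly_add [simp]: "eval_poly (p + q) x = eval_poly p x + eval_poly q x"
proof -
  let ?K = "Poly_Mapping.keys p \<union> Poly_Mapping.keys q"
  have "Poly_Mapping.keys (p + q) \<subseteq> ?K" by (rule keys_add)
  then show ?thesis
    by (simp add: eval_poly_superset[of ?K] lookup_add sum.distrib algebra_simps)
qed

lemma eval_poly_scale [simp]: "eval_poly (poly_scale c p) x = c * eval_poly p x"
proof -
  have "Poly_Mapping.keys (poly_scale c p) \<subseteq> Poly_Mapping.keys p"
    by (auto simp: in_keys_iff)
  then show ?thesis
    by (simp add: eval_poly_superset[of "Poly_Mapping.keys p"] sum_distrib_left algebra_simps)
qed

lemma eval_poly_sum [simp]: "eval_poly (\<Sum>i\<in>A. f i) x = (\<Sum>i\<in>A. eval_poly (f i) x)"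
  by (induction A rule: infinite_finite_induct) auto

lemma sum_single_keys: "p = (\<Sum>\<alpha>\<in>Poly_Mapping.keys p. Poly_Mapping.single \<alpha> (Poly_Mapping.lookup p \<alpha>))"
proof (rule poly_mapping_eqI)
  fix \<beta>
  show "Poly_Mapping.lookup p \<beta> = Poly_Mapping.lookup
      (\<Sum>\<alpha>\<in>Poly_Mapping.keys p. Poly_Mapping.single \<alpha> (Poly_Mapping.lookup p \<alpha>)) \<beta>"
    by (cases "\<beta> \<in> Poly_Mapping.keys p")
       (auto simp: lookup_sum lookup_single when_def in_keys_iff)
qed

lemma eval_poly_mult [simp]: "eval_poly (p * q) x = eval_poly p x * eval_poly q x"
proof -
  let ?s = "\<lambda>p \<alpha>. Poly_Mapping.single \<alpha> (Poly_Mapping.lookup p \<alpha>)"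
  have "eval_poly ((\<Sum>\<alpha>\<in>Poly_Mapping.keys p. ?s p \<alpha>) * (\<Sum>\<beta>\<in>Poly_Mapping.keys q. ?s q \<beta>)) x =
      eval_poly (\<Sum>\<alpha>\<in>Poly_Mapping.keys p. ?s p \<alpha>) x * eval_poly (\<Sum>\<beta>\<in>Poly_Mapping.keys q. ?s q \<beta>) x"
    by (simp add: sum_product mult_single power_add prod.distrib algebra_simps)
  then show ?thesis by (simp flip: sum_single_keys)
qed

definition polynomial_fun :: "('a::comm_semiring_1 ^ 'd::finite \<Rightarrow> 'a) \<Rightarrow> bool" where
  "polynomial_fun F \<longleftrightarrow> (\<exists>p. \<forall>x. eval_poly p x = F x)"

named_theorems polynomial_fun_intros

lemma polynomial_fun_const [polynomial_fun_intros]: "polynomial_fun (\<lambda>x. c)"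
  unfolding polynomial_fun_def by (rule exI[of _ "Poly_Mapping.single 0 c"]) simp

lemma polynomial_fun_component [polynomial_fun_intros]: "polynomial_fun (\<lambda>x. x $ i)"
proof -
  have "eval_poly (Poly_Mapping.single (axis i 1) 1) x = x $ i" for x :: "'a ^ 'b"
  proof -
    have "(\<Prod>j\<in>UNIV. x $ j ^ (axis i 1 $ j)) = (\<Prod>j\<in>UNIV. if j = i then x $ j else 1)"
      by (intro prod.cong) (auto simp: axis_def)
    then show ?thesis by simp
  qed
  then show ?thesis unfolding polynomial_fun_def by blast
qed

lemma polynomial_fun_add [polynomial_fun_intros]:
  "polynomial_fun F \<Longrightarrow> polynomial_fun G \<Longrightarrow> polynomial_fun (\<lambda>x. F x + G x)"
  unfolding polynomial_fun_def by (metis eval_poly_add)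

lemma polynomial_fun_mult [polynomial_fun_intros]:
  "polynomial_fun F \<Longrightarrow> polynomial_fun G \<Longrightarrow> polynomial_fun (\<lambda>x. F x * G x)"
  unfolding polynomial_fun_def by (metis eval_poly_mult)

lemma polynomial_fun_diff [polynomial_fun_intros]:
  fixes F G :: "'a::comm_ring_1 ^ 'd::finite \<Rightarrow> 'a"
  assumes "polynomial_fun F" "polynomial_fun G"
  shows "polynomial_fun (\<lambda>x. F x - G x)"
  using polynomial_fun_add[OF assms(1) polynomial_fun_mult[OF polynomial_fun_const[of "-1"] assms(2)]]
  by simp

lemma polynomial_fun_power [polynomial_fun_intros]:
  "polynomial_fun F \<Longrightarrow> polynomial_fun (\<lambda>x. F x ^ n)"
  by (induction n) (auto intro: polynomial_fun_intros)

lemma polynomial_fun_sum [polynomial_fun_intros]: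
  "(\<And>i. i \<in> A \<Longrightarrow> polynomial_fun (F i)) \<Longrightarrow> polynomial_fun (\<lambda>x. \<Sum>i\<in>A. F i x)"
  by (induction A rule: infinite_finite_induct) (auto intro: polynomial_fun_intros)

lemma polynomial_fun_prod [polynomial_fun_intros]:
  "(\<And>i. i \<in> A \<Longrightarrow> polynomial_fun (F i)) \<Longrightarrow> polynomial_fun (\<lambda>x. \<Prod>i\<in>A. F i x)"
  by (induction A rule: infinite_finite_induct) (auto intro: polynomial_fun_intros)

lemma tendsto_polynomial_fun:
  fixes F :: "'a::real_normed_field ^ 'd::finite \<Rightarrow> 'a"
  assumes "polynomial_fun F" "\<And>i. ((\<lambda>h. v h $ i) \<longlongrightarrow> w $ i) X"
  shows "((\<lambda>h. F (v h)) \<longlongrightarrow> F w) X"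
proof -
  obtain p where "\<And>x. F x = eval_poly p x" using assms(1) unfolding polynomial_fun_def by metis
  then show ?thesis
    by (auto simp: eval_poly_def intro!: tendsto_intros assms(2))
qed

lemma partial_deriv_add: "partial_deriv i (p + q) = partial_deriv i p + partial_deriv i q"
  by (rule poly_mapping_eqI) (simp add: lookup_partial_deriv lookup_add algebra_simps)

lemma dir_deriv_add: "dir_deriv v (p + q) = dir_deriv v p + dir_deriv v q"
  by (rule poly_mapping_eqI)
     (simp add: lookup_dir_deriv lookup_add partial_deriv_add algebra_simps sum.distrib)

lemma partial_deriv_single:
  "partial_deriv i (Poly_Mapping.single \<alpha> c) = Poly_Mapping.single (\<alpha> - axis i 1) (of_nat (\<alpha> $ i) * c)"
  by (cases "c = 0") (simp_all add: partial_deriv_def)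

lemma partial_deriv_zero [simp]: "partial_deriv i 0 = 0"
  by (simp add: partial_deriv_def)

lemma dir_deriv_zero [simp]: "dir_deriv v 0 = 0"
  by (rule poly_mapping_eqI) (simp add: lookup_dir_deriv)

lemma dir_deriv_sum: "dir_deriv v (\<Sum>i\<in>A. f i) = (\<Sum>i\<in>A. dir_deriv v (f i))"
  by (induction A rule: infinite_finite_induct) (auto simp: dir_deriv_add)

lemma dir_deriv_axis: "dir_deriv (axis i 1) p = partial_deriv i p"
proof (rule poly_mapping_eqI)
  fix \<beta>
  have "(\<Sum>j\<in>UNIV. axis i 1 $ j * Poly_Mapping.lookup (partial_deriv j p) \<beta>) =
      (\<Sum>j\<in>UNIV. if j = i then Poly_Mapping.lookup (partial_deriv j p) \<beta> else 0)"
    by (intro sum.cong) (auto simp: axis_def)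
  then show "Poly_Mapping.lookup (dir_deriv (axis i 1) p) \<beta> = Poly_Mapping.lookup (partial_deriv i p) \<beta>"
    by (simp add: lookup_dir_deriv)
qed

definition degree_le :: "nat \<Rightarrow> ('a::zero, 'd::finite) mpoly \<Rightarrow> bool" where
  "degree_le N p \<longleftrightarrow> (\<forall>\<alpha>\<in>Poly_Mapping.keys p. (\<Sum>i\<in>UNIV. \<alpha> $ i) \<le> N)"

lemma degree_le_mono: "degree_le M p \<Longrightarrow> M \<le> N \<Longrightarrow> degree_le N p"
  unfolding degree_le_def by force

lemma ex_degree_le: "\<exists>N. degree_le N p"
proof
  show "degree_le (\<Sum>\<alpha>\<in>Poly_Mapping.keys p. \<Sum>i\<in>UNIV. \<alpha> $ i) p"
    unfolding degree_le_def by (auto intro!: member_le_sum)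
qed

lemma degree_le_dir_deriv:
  assumes "degree_le N p"
  shows "degree_le N (dir_deriv v p)"
  unfolding degree_le_def
proof
  fix \<beta> assume "\<beta> \<in> Poly_Mapping.keys (dir_deriv v p)"
  then have "(\<Sum>j\<in>UNIV. v $ j * Poly_Mapping.lookup (partial_deriv j p) \<beta>) \<noteq> 0"
    by (simp add: in_keys_iff lookup_dir_deriv)
  then obtain j where "v $ j * Poly_Mapping.lookup (partial_deriv j p) \<beta> \<noteq> 0"
    by (meson sum.neutral)
  then have "\<beta> + axis j 1 \<in> Poly_Mapping.keys p"
    by (auto simp: lookup_partial_deriv in_keys_iff)
  then have "(\<Sum>i\<in>UNIV. (\<beta> + axis j 1) $ i) \<le> N"
    using assms unfolding degree_le_def by blast
  then show "(\<Sum>i\<in>UNIV. \<beta> $ i) \<le> N"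
    by (simp add: sum.distrib)
qed

lemma degree_le_dir_deriv_funpow: "degree_le N p \<Longrightarrow> degree_le N ((dir_deriv v ^^ r) p)"
  by (induction r) (auto intro: degree_le_dir_deriv)


subsection \<open>Taylor expansion\<close>

definition line_poly :: "'a::comm_semiring_1 ^ 'd \<Rightarrow> 'a ^ 'd \<Rightarrow> ('a, 'd::finite) mpoly \<Rightarrow> 'a poly" where
  "line_poly x v p = (\<Sum>\<alpha>\<in>Poly_Mapping.keys p.
     [:Poly_Mapping.lookup p \<alpha>:] * (\<Prod>i\<in>UNIV. [:x $ i, v $ i:] ^ (\<alpha> $ i)))"

lemma poly_line_poly: "poly (line_poly x v p) t = eval_poly p (x + t *s v)"
  by (simp add: line_poly_def eval_poly_def poly_sum poly_prod)

lemma degree_line_poly_le: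
  assumes "degree_le N p"
  shows "degree (line_poly x v p) \<le> N"
  unfolding line_poly_def
proof (rule degree_sum_le)
  fix \<alpha> assume \<alpha>: "\<alpha> \<in> Poly_Mapping.keys p"
  have "degree (\<Prod>i\<in>UNIV. [:x $ i, v $ i:] ^ (\<alpha> $ i)) \<le>
      (\<Sum>i\<in>UNIV. degree ([:x $ i, v $ i:] ^ (\<alpha> $ i)))"
    by (rule order_trans[OF degree_prod_sum_le]) auto
  also have "\<dots> \<le> (\<Sum>i\<in>UNIV. \<alpha> $ i)"
  proof (rule sum_mono)
    fix i
    have "degree ([:x $ i, v $ i:] ^ (\<alpha> $ i)) \<le> degree [:x $ i, v $ i:] * \<alpha> $ i"
      by (rule degree_power_le)
    also have "\<dots> \<le> 1 * \<alpha> $ i" by (rule mult_right_mono) auto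
    finally show "degree ([:x $ i, v $ i:] ^ (\<alpha> $ i)) \<le> \<alpha> $ i" by simp
  qed
  also have "\<dots> \<le> N" using assms \<alpha> by (simp add: degree_le_def)
  finally show "degree ([:Poly_Mapping.lookup p \<alpha>:] * (\<Prod>i\<in>UNIV. [:x $ i, v $ i:] ^ (\<alpha> $ i))) \<le> N"
    by (rule order_trans[rotated]) (simp add: degree_smult_le)
qed simp

lemma line_poly_superset:
  assumes "finite K" "Poly_Mapping.keys p \<subseteq> K"
  shows "line_poly x v p = (\<Sum>\<alpha>\<in>K. [:Poly_Mapping.lookup p \<alpha>:] * (\<Prod>i\<in>UNIV. [:x $ i, v $ i:] ^ (\<alpha> $ i)))"
  unfolding line_poly_def
  by (rule sum.mono_neutral_left) (use assms in \<open>auto simp: in_keys_iff\<close>)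

lemma line_poly_single:
  "line_poly x v (Poly_Mapping.single \<alpha> c) = [:c:] * (\<Prod>i\<in>UNIV. [:x $ i, v $ i:] ^ (\<alpha> $ i))"
  by (subst line_poly_superset[of "{\<alpha>}"]) auto

lemma line_poly_add: "line_poly x v (p + q) = line_poly x v p + line_poly x v q"
proof -
  let ?K = "Poly_Mapping.keys p \<union> Poly_Mapping.keys q"
  have "Poly_Mapping.keys (p + q) \<subseteq> ?K" by (rule keys_add)
  then show ?thesis
    by (simp add: line_poly_superset[of ?K] lookup_add sum.distrib smult_add_left)
qed

lemma line_poly_sum: "line_poly x v (\<Sum>i\<in>A. f i) = (\<Sum>i\<in>A. line_poly x v (f i))"
  by (induction A rule: infinite_finite_induct) (auto simp: line_poly_add line_poly_def[of _ _ 0])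

lemma pderiv_sum: "pderiv (\<Sum>i\<in>A. f i) = (\<Sum>i\<in>A. pderiv (f i))"
  by (induction A rule: infinite_finite_induct) (auto simp: pderiv_add)

lemma pderiv_line_poly:
  fixes p :: "('a::field_char_0, 'd::finite) mpoly"
  shows "pderiv (line_poly x v p) = line_poly x v (dir_deriv v p)"
proof -
  have single: "pderiv (line_poly x v (Poly_Mapping.single \<alpha> c)) = line_poly x v (dir_deriv v (Poly_Mapping.single \<alpha> c))"
    for \<alpha> and c :: 'a
  proof -
    let ?l = "\<lambda>i. [:x $ i, v $ i:]"
    have "pderiv (line_poly x v (Poly_Mapping.single \<alpha> c)) =
        smult c (\<Sum>i\<in>UNIV. (\<Prod>j\<in>UNIV - {i}. ?l j ^ (\<alpha> $ j)) * pderiv (?l i ^ (\<alpha> $ i)))"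
      by (simp add: line_poly_single pderiv_smult pderiv_prod)
    also have "\<dots> = (\<Sum>i\<in>UNIV. smult c ((\<Prod>j\<in>UNIV - {i}. ?l j ^ (\<alpha> $ j)) * pderiv (?l i ^ (\<alpha> $ i))))"
      using sum_distrib_left[of "[:c:]" _ "UNIV :: 'd set"] by simp
    also have "\<dots> = (\<Sum>i\<in>UNIV. line_poly x v (Poly_Mapping.single (\<alpha> - axis i 1) (v $ i * (of_nat (\<alpha> $ i) * c))))"
    proof (rule sum.cong)
      fix i
      have "(\<Prod>j\<in>UNIV. ?l j ^ ((\<alpha> - axis i 1) $ j)) = ?l i ^ (\<alpha> $ i - 1) * (\<Prod>j\<in>UNIV - {i}. ?l j ^ (\<alpha> $ j))"
        by (subst prod.remove[of _ i]) (auto simp: axis_def intro!: prod.cong)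
      then show "smult c ((\<Prod>j\<in>UNIV - {i}. ?l j ^ (\<alpha> $ j)) * pderiv (?l i ^ (\<alpha> $ i))) =
        line_poly x v (Poly_Mapping.single (\<alpha> - axis i 1) (v $ i * (of_nat (\<alpha> $ i) * c)))"
        by (simp add: line_poly_single pderiv_power pderiv_pCons algebra_simps)
    qed simp
    also have "\<dots> = line_poly x v (dir_deriv v (Poly_Mapping.single \<alpha> c))"
    proof -
      have "dir_deriv v (Poly_Mapping.single \<alpha> c) =
          (\<Sum>i\<in>UNIV. Poly_Mapping.single (\<alpha> - axis i 1) (v $ i * (of_nat (\<alpha> $ i) * c)))"
        by (simp add: dir_deriv_def partial_deriv_single poly_scale_def)
      then show ?thesis by (simp add: line_poly_sum)
    qed
    finally show ?thesis .
  qed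
  have "pderiv (line_poly x v (\<Sum>\<alpha>\<in>Poly_Mapping.keys p. Poly_Mapping.single \<alpha> (Poly_Mapping.lookup p \<alpha>))) =
      line_poly x v (dir_deriv v (\<Sum>\<alpha>\<in>Poly_Mapping.keys p. Poly_Mapping.single \<alpha> (Poly_Mapping.lookup p \<alpha>)))"
    by (simp only: line_poly_sum dir_deriv_sum pderiv_sum single)
  then show ?thesis by (simp flip: sum_single_keys)
qed

lemma taylor_line:
  fixes p :: "('a::field_char_0, 'd::finite) mpoly"
  assumes "degree_le N p"
  shows "eval_poly p (x + t *s v) = (\<Sum>r\<le>N. t ^ r / fact r * eval_poly ((dir_deriv v ^^ r) p) x)"
proof -
  have "(pderiv ^^ r) (line_poly x v p) = line_poly x v ((dir_deriv v ^^ r) p)" for r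
    by (induction r) (simp_all add: pderiv_line_poly)
  then have "coeff (line_poly x v ((dir_deriv v ^^ r) p)) 0 = fact r * coeff (line_poly x v p) r" for r
    using coeff_higher_pderiv[of r "line_poly x v p" 0] by (simp add: pochhammer_fact)
  then have "eval_poly ((dir_deriv v ^^ r) p) x = fact r * coeff (line_poly x v p) r" for r
    using poly_line_poly[of x v "(dir_deriv v ^^ r) p" 0] by (simp add: poly_0_coeff_0)
  then have "(\<Sum>r\<le>N. t ^ r / fact r * eval_poly ((dir_deriv v ^^ r) p) x) = (\<Sum>r\<le>N. coeff (line_poly x v p) r * t ^ r)"
    by (simp add: mult.commute)
  also have "\<dots> = poly (line_poly x v p) t"
    unfolding poly_altdef
    by (rule sum.mono_neutral_right) (use degree_line_poly_le[OF assms] in \<open>auto simp: coeff_eq_0\<close>)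
  finally show ?thesis by (simp add: poly_line_poly)
qed

definition bounded_tuples :: "'i set \<Rightarrow> nat \<Rightarrow> ('i \<Rightarrow> nat) set" where
  "bounded_tuples I N = {\<gamma>. (\<forall>i\<in>I. \<gamma> i \<le> N) \<and> (\<forall>i. i \<notin> I \<longrightarrow> \<gamma> i = 0)}"

lemma finite_bounded_tuples:
  assumes "finite I"
  shows "finite (bounded_tuples I N)"
  using finite_set_of_finite_funs[OF assms, of "{..N}" 0]
  by (rule rev_finite_subset) (auto simp: bounded_tuples_def)

lemma sum_bounded_tuples_insert:
  assumes "i \<notin> I"
  shows "(\<Sum>\<gamma>\<in>bounded_tuples (insert i I) N. F \<gamma>) = (\<Sum>\<gamma>\<in>bounded_tuples I N. \<Sum>r\<le>N. F (\<gamma>(i := r)))"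
proof -
  have "(\<Sum>\<gamma>\<in>bounded_tuples (insert i I) N. F \<gamma>) =
      (\<Sum>(\<gamma>, r)\<in>bounded_tuples I N \<times> {..N}. F (\<gamma>(i := r)))"
    by (rule sum.reindex_bij_witness[of _ "\<lambda>(\<gamma>, r). \<gamma>(i := r)" "\<lambda>\<gamma>. (\<gamma>(i := 0), \<gamma> i)"])
       (use assms in \<open>auto simp: bounded_tuples_def fun_eq_iff\<close>)
  then show ?thesis by (simp add: sum.cartesian_product)
qed

definition multi_deriv :: "('i \<Rightarrow> 'a::comm_semiring_1 ^ 'd) \<Rightarrow> ('i \<Rightarrow> nat) \<Rightarrow> 'i set \<Rightarrow> ('a, 'd::finite) mpoly \<Rightarrow> ('a, 'd) mpoly" where
  "multi_deriv v \<gamma> I p = Finite_Set.fold (\<lambda>i. dir_deriv (v i) ^^ \<gamma> i) p I"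

lemma multi_deriv_empty [simp]: "multi_deriv v \<gamma> {} p = p"
  by (simp add: multi_deriv_def)

lemma multi_deriv_comp_fun_commute: "comp_fun_commute (\<lambda>i. dir_deriv (v i) ^^ \<gamma> i)"
proof -
  interpret comp_fun_commute "\<lambda>i. dir_deriv (v i)"
    by unfold_locales (simp add: fun_eq_iff dir_deriv_commute)
  show ?thesis by (rule comp_fun_commute_funpow)
qed

lemma multi_deriv_insert:
  assumes "finite I" "i \<notin> I"
  shows "multi_deriv v \<gamma> (insert i I) p = (dir_deriv (v i) ^^ \<gamma> i) (multi_deriv v \<gamma> I p)"
proof -
  interpret comp_fun_commute "\<lambda>i. dir_deriv (v i) ^^ \<gamma> i"
    by (rule multi_deriv_comp_fun_commute)
  show ?thesis unfolding multi_deriv_def using assms by (rule fold_insert)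
qed

lemma multi_deriv_cong:
  assumes "finite I" "\<And>i. i \<in> I \<Longrightarrow> \<gamma> i = \<gamma>' i"
  shows "multi_deriv v \<gamma> I p = multi_deriv v \<gamma>' I p"
  using assms by (induction I rule: finite_induct) (auto simp: multi_deriv_insert)

lemma degree_le_multi_deriv: "finite I \<Longrightarrow> degree_le N p \<Longrightarrow> degree_le N (multi_deriv v \<gamma> I p)"
  by (induction I rule: finite_induct) (auto simp: multi_deriv_insert intro: degree_le_dir_deriv_funpow)

lemma taylor_multi:
  fixes p :: "('a::field_char_0, 'd::finite) mpoly" and I :: "'i set"
  assumes "finite I" "degree_le N p"
  shows "eval_poly p (x + (\<Sum>i\<in>I. s i *s v i)) =
     (\<Sum>\<gamma>\<in>bounded_tuples I N. (\<Prod>i\<in>I. s i ^ \<gamma> i / fact (\<gamma> i)) * eval_poly (multi_deriv v \<gamma> I p) x)"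
  using assms(1)
proof (induction I arbitrary: x rule: finite_induct)
  case empty
  have "bounded_tuples ({} :: 'i set) N = {\<lambda>_. 0}" by (auto simp: bounded_tuples_def)
  then show ?case by simp
next
  case (insert i I)
  have "eval_poly p (x + (\<Sum>i\<in>insert i I. s i *s v i)) = eval_poly p ((x + s i *s v i) + (\<Sum>i\<in>I. s i *s v i))"
    using insert.hyps by (simp add: add.assoc)
  also have "\<dots> = (\<Sum>\<gamma>\<in>bounded_tuples I N. (\<Prod>i\<in>I. s i ^ \<gamma> i / fact (\<gamma> i)) *
      eval_poly (multi_deriv v \<gamma> I p) (x + s i *s v i))"
    by (rule insert.IH)
  also have "\<dots> = (\<Sum>\<gamma>\<in>bounded_tuples I N. \<Sum>r\<le>N.
      (\<Prod>j\<in>insert i I. s j ^ (\<gamma>(i := r)) j / fact ((\<gamma>(i := r)) j)) *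
      eval_poly (multi_deriv v (\<gamma>(i := r)) (insert i I) p) x)"
  proof (rule sum.cong)
    fix \<gamma>
    have prod_eq: "(\<Prod>j\<in>insert i I. s j ^ (\<gamma>(i := r)) j / fact ((\<gamma>(i := r)) j)) =
        s i ^ r / fact r * (\<Prod>j\<in>I. s j ^ \<gamma> j / fact (\<gamma> j))" for r
    proof -
      have "(\<Prod>j\<in>I. s j ^ (\<gamma>(i := r)) j / fact ((\<gamma>(i := r)) j)) = (\<Prod>j\<in>I. s j ^ \<gamma> j / fact (\<gamma> j))"
        using insert.hyps by (intro prod.cong) auto
      then show ?thesis using insert.hyps by simp
    qed
    have deriv_eq: "multi_deriv v (\<gamma>(i := r)) (insert i I) p = (dir_deriv (v i) ^^ r) (multi_deriv v \<gamma> I p)" for r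
    proof -
      have "multi_deriv v (\<gamma>(i := r)) I p = multi_deriv v \<gamma> I p"
        using insert.hyps by (intro multi_deriv_cong) auto
      then show ?thesis using insert.hyps by (simp add: multi_deriv_insert)
    qed
    show "(\<Prod>i\<in>I. s i ^ \<gamma> i / fact (\<gamma> i)) * eval_poly (multi_deriv v \<gamma> I p) (x + s i *s v i) =
        (\<Sum>r\<le>N. (\<Prod>j\<in>insert i I. s j ^ (\<gamma>(i := r)) j / fact ((\<gamma>(i := r)) j)) *
          eval_poly (multi_deriv v (\<gamma>(i := r)) (insert i I) p) x)"
      unfolding prod_eq deriv_eq
        taylor_line[OF degree_le_multi_deriv[OF insert.hyps(1) assms(2)]]
      by (simp add: sum_distrib_left mult_ac)
  qed simp
  finally show ?case by (simp add: sum_bounded_tuples_insert insert.hyps)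
qed

subsection \<open>Interpolation conditions as limits of scaled differences\<close>

lemma iter_deriv_dir_deriv: "iter_deriv (\<lambda>i. dir_deriv (v i)) \<alpha> p = multi_deriv v (($) \<alpha>) UNIV p"
  by (simp add: iter_deriv_def multi_deriv_def)

lemma iter_deriv_partial_deriv:
  fixes p :: "('a::comm_semiring_1, 'd::finite) mpoly"
  shows "iter_deriv partial_deriv \<alpha> p = multi_deriv (\<lambda>i. axis i 1) (($) \<alpha>) UNIV p"
proof -
  have "dir_deriv (axis i (1 :: 'a)) = partial_deriv i" for i :: 'd
    by (rule ext) (rule dir_deriv_axis)
  then show ?thesis by (simp add: iter_deriv_def multi_deriv_def)
qed

lemma sum_atMost_vec_prod:
  fixes \<alpha> :: "nat ^ 'd::finite" and F :: "'d \<Rightarrow> nat \<Rightarrow> 'a::comm_semiring_1"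
  shows "(\<Sum>\<beta>\<in>{..\<alpha>}. \<Prod>i\<in>UNIV. F i (\<beta> $ i)) = (\<Prod>i\<in>UNIV. \<Sum>b\<le>\<alpha> $ i. F i b)"
proof -
  have "(\<Prod>i\<in>UNIV. \<Sum>b\<in>{..\<alpha> $ i}. F i b) = (\<Sum>g\<in>Pi\<^sub>E UNIV (\<lambda>i. {..\<alpha> $ i}). \<Prod>i\<in>UNIV. F i (g i))"
    by (rule prod_sum_PiE) auto
  also have "\<dots> = (\<Sum>\<beta>\<in>{..\<alpha>}. \<Prod>i\<in>UNIV. F i (\<beta> $ i))"
    by (rule sum.reindex_bij_witness[of _ "\<lambda>\<beta>. ($) \<beta>" "\<lambda>g. \<chi> i. g i"])
       (auto simp: less_eq_vec_def)
  finally show ?thesis by simp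
qed

definition grid_difference ::
    "('d \<Rightarrow> 'a::field ^ 'd) \<Rightarrow> nat ^ 'd \<Rightarrow> 'a ^ 'd \<Rightarrow> 'a \<Rightarrow> ('a, 'd::finite) mpoly \<Rightarrow> 'a" where
  "grid_difference \<rho> \<alpha> \<xi> h f = (\<Sum>\<beta>\<in>{..\<alpha>}. (\<Prod>i\<in>UNIV. diff_coeff (\<alpha> $ i) (\<beta> $ i) / h ^ (\<alpha> $ i)) *
     eval_poly f (\<xi> + h *s (\<Sum>i\<in>UNIV. of_nat (\<beta> $ i) *s \<rho> i)))"

lemma grid_difference_tendsto:
  fixes \<rho> :: "'d::finite \<Rightarrow> 'a::real_normed_field ^ 'd"
  shows "((\<lambda>h. grid_difference \<rho> \<alpha> \<xi> h f) \<longlongrightarrow>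
     eval_poly (iter_deriv (\<lambda>i. dir_deriv (\<rho> i)) \<alpha> f) \<xi>) (at 0)"
proof -
  obtain M where "degree_le M f" using ex_degree_le by blast
  define N where "N = M + (\<Sum>i\<in>UNIV. \<alpha> $ i)"
  have N: "degree_le N f" "\<alpha> $ i \<le> N" for i
    using \<open>degree_le M f\<close> member_le_sum[of i UNIV "($) \<alpha>"]
    by (auto simp: N_def intro: degree_le_mono trans_le_add2)
  let ?G = "bounded_tuples (UNIV :: 'd set) N"
  let ?E = "\<lambda>\<gamma>. eval_poly (multi_deriv \<rho> \<gamma> UNIV f) \<xi>"
  let ?q = "\<lambda>h m r. (\<Sum>s\<le>m. diff_coeff m s * (of_nat s * h) ^ r) / h ^ m"
  have eq: "grid_difference \<rho> \<alpha> \<xi> h f = (\<Sum>\<gamma>\<in>?G. (\<Prod>i\<in>UNIV. ?q h (\<alpha> $ i) (\<gamma> i) / fact (\<gamma> i)) * ?E \<gamma>)" for h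
  proof -
    have taylor: "eval_poly f (\<xi> + h *s (\<Sum>i\<in>UNIV. of_nat (\<beta> $ i) *s \<rho> i)) =
        (\<Sum>\<gamma>\<in>?G. (\<Prod>i\<in>UNIV. (of_nat (\<beta> $ i) * h) ^ \<gamma> i / fact (\<gamma> i)) * ?E \<gamma>)" for \<beta> :: "nat ^ 'd"
    proof -
      have "h *s (\<Sum>i\<in>UNIV. of_nat (\<beta> $ i) *s \<rho> i) = (\<Sum>i\<in>UNIV. (of_nat (\<beta> $ i) * h) *s \<rho> i)"
        by (simp add: vec_eq_iff sum_distrib_left mult_ac)
      then show ?thesis using taylor_multi[OF finite N(1)] by simp
    qed
    have "grid_difference \<rho> \<alpha> \<xi> h f = (\<Sum>\<gamma>\<in>?G. \<Sum>\<beta>\<in>{..\<alpha>}.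
        (\<Prod>i\<in>UNIV. diff_coeff (\<alpha> $ i) (\<beta> $ i) / h ^ (\<alpha> $ i) * ((of_nat (\<beta> $ i) * h) ^ \<gamma> i / fact (\<gamma> i))) * ?E \<gamma>)"
      unfolding grid_difference_def taylor sum_distrib_left prod.distrib
      by (subst sum.swap) (simp add: mult.assoc)
    also have "\<dots> = (\<Sum>\<gamma>\<in>?G. (\<Prod>i\<in>UNIV. \<Sum>b\<le>\<alpha> $ i.
        diff_coeff (\<alpha> $ i) b / h ^ (\<alpha> $ i) * ((of_nat b * h) ^ \<gamma> i / fact (\<gamma> i))) * ?E \<gamma>)"
    proof (rule sum.cong)
      fix \<gamma> :: "'d \<Rightarrow> nat"
      show "(\<Sum>\<beta>\<in>{..\<alpha>}.
          (\<Prod>i\<in>UNIV. diff_coeff (\<alpha> $ i) (\<beta> $ i) / h ^ (\<alpha> $ i) * ((of_nat (\<beta> $ i) * h) ^ \<gamma> i / fact (\<gamma> i))) * ?E \<gamma>) =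
        (\<Prod>i\<in>UNIV. \<Sum>b\<le>\<alpha> $ i. diff_coeff (\<alpha> $ i) b / h ^ (\<alpha> $ i) * ((of_nat b * h) ^ \<gamma> i / fact (\<gamma> i))) * ?E \<gamma>"
        using sum_atMost_vec_prod[of "\<lambda>i b. diff_coeff (\<alpha> $ i) b / h ^ (\<alpha> $ i) * ((of_nat b * h) ^ \<gamma> i / fact (\<gamma> i))" \<alpha>]
        by (simp only: sum_distrib_right[symmetric])
    qed simp
    finally show ?thesis by (simp add: sum_divide_distrib)
  qed
  have "((\<lambda>h. grid_difference \<rho> \<alpha> \<xi> h f) \<longlongrightarrow>
      (\<Sum>\<gamma>\<in>?G. (\<Prod>i\<in>UNIV. (if \<gamma> i = \<alpha> $ i then fact (\<alpha> $ i) else 0) / fact (\<gamma> i)) * ?E \<gamma>)) (at 0)"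
    unfolding eq by (intro tendsto_intros diff_quotient_power_tendsto) auto
  moreover have "(\<Sum>\<gamma>\<in>?G. (\<Prod>i\<in>UNIV. (if \<gamma> i = \<alpha> $ i then fact (\<alpha> $ i) else 0) / fact (\<gamma> i)) * ?E \<gamma>) =
      (\<Sum>\<gamma>\<in>?G. if \<gamma> = ($) \<alpha> then ?E (($) \<alpha>) else 0)"
  proof (rule sum.cong)
    fix \<gamma> :: "'d \<Rightarrow> nat"
    show "(\<Prod>i\<in>UNIV. (if \<gamma> i = \<alpha> $ i then fact (\<alpha> $ i) else 0) / fact (\<gamma> i)) * ?E \<gamma> =
        (if \<gamma> = ($) \<alpha> then ?E (($) \<alpha>) else 0)"
    proof (cases "\<gamma> = ($) \<alpha>")
      case False
      then obtain i where "\<gamma> i \<noteq> \<alpha> $ i" by blast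
      then have "(\<Prod>i\<in>UNIV. (if \<gamma> i = \<alpha> $ i then fact (\<alpha> $ i) else 0 :: 'a) / fact (\<gamma> i)) = 0"
        by (intro prod_zero) auto
      then show ?thesis using False by simp
    qed simp
  qed simp
  moreover have "\<dots> = ?E (($) \<alpha>)"
    using N(2) by (simp add: finite_bounded_tuples) (auto simp: bounded_tuples_def)
  ultimately show ?thesis by (simp add: iter_deriv_dir_deriv)
qed

lemma multi_deriv_add_exponent:
  assumes "finite I" "i \<in> I"
  shows "multi_deriv v (\<gamma>(i := r + \<gamma> i)) I p = (dir_deriv (v i) ^^ r) (multi_deriv v \<gamma> I p)"
proof -
  have I: "insert i (I - {i}) = I" using assms by auto
  have "multi_deriv v (\<gamma>(i := r + \<gamma> i)) (insert i (I - {i})) p =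
      (dir_deriv (v i) ^^ (r + \<gamma> i)) (multi_deriv v (\<gamma>(i := r + \<gamma> i)) (I - {i}) p)"
    using assms by (subst multi_deriv_insert) auto
  also have "multi_deriv v (\<gamma>(i := r + \<gamma> i)) (I - {i}) p = multi_deriv v \<gamma> (I - {i}) p"
    using assms by (intro multi_deriv_cong) auto
  also have "(dir_deriv (v i) ^^ (r + \<gamma> i)) (multi_deriv v \<gamma> (I - {i}) p) =
      (dir_deriv (v i) ^^ r) (multi_deriv v \<gamma> (insert i (I - {i})) p)"
    using assms by (subst multi_deriv_insert) (auto simp: funpow_add)
  finally show ?thesis by (simp only: I)
qed

lemma multi_deriv_collect:
  fixes v :: "'i::finite \<Rightarrow> 'a::comm_semiring_1 ^ 'd::finite"
  assumes "finite K"
  shows "multi_deriv (\<lambda>k. v (\<pi> k)) \<gamma> K p = multi_deriv v (\<lambda>i. \<Sum>k | k \<in> K \<and> \<pi> k = i. \<gamma> k) UNIV p"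
  using assms
proof (induction K rule: finite_induct)
  case empty
  have "multi_deriv v (\<lambda>_. 0) I p = p" if "finite I" for I
    using that by (induction I rule: finite_induct) (auto simp: multi_deriv_insert)
  then show ?case by simp
next
  case (insert k K)
  let ?s = "\<lambda>K i. \<Sum>k | k \<in> K \<and> \<pi> k = i. \<gamma> k"
  have "?s (insert k K) i = ((?s K)(\<pi> k := \<gamma> k + ?s K (\<pi> k))) i" for i
  proof (cases "i = \<pi> k")
    case True
    have "{l. l \<in> insert k K \<and> \<pi> l = \<pi> k} = insert k {l. l \<in> K \<and> \<pi> l = \<pi> k}" by auto
    then show ?thesis using True insert.hyps by simp
  next
    case False
    then have "{l. l \<in> insert k K \<and> \<pi> l = i} = {l. l \<in> K \<and> \<pi> l = i}" by auto
    then show ?thesis using False by simp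
  qed
  then have "?s (insert k K) = (?s K)(\<pi> k := \<gamma> k + ?s K (\<pi> k))" by (rule ext)
  then show ?case
    using insert multi_deriv_add_exponent[of UNIV "\<pi> k" v "?s K" "\<gamma> k" p]
    by (simp add: multi_deriv_insert)
qed

lemma eval_poly_diff_op:
  "eval_poly (diff_op q f) x = (\<Sum>\<alpha>\<in>Poly_Mapping.keys q. Poly_Mapping.lookup q \<alpha> * eval_poly (iter_deriv partial_deriv \<alpha> f) x)"
  by (simp add: diff_op_def)

lemma eval_poly_diff_op_superset:
  assumes "finite K" "Poly_Mapping.keys q \<subseteq> K"
  shows "eval_poly (diff_op q f) x = (\<Sum>\<alpha>\<in>K. Poly_Mapping.lookup q \<alpha> * eval_poly (iter_deriv partial_deriv \<alpha> f) x)"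
  unfolding eval_poly_diff_op
  by (rule sum.mono_neutral_left) (use assms in \<open>auto simp: in_keys_iff\<close>)

lemma eval_poly_diff_op_add:
  "eval_poly (diff_op (p + q) f) x = eval_poly (diff_op p f) x + eval_poly (diff_op q f) x"
proof -
  let ?K = "Poly_Mapping.keys p \<union> Poly_Mapping.keys q"
  have "Poly_Mapping.keys (p + q) \<subseteq> ?K" by (rule keys_add)
  then show ?thesis
    by (simp add: eval_poly_diff_op_superset[of ?K] lookup_add sum.distrib algebra_simps)
qed

lemma eval_poly_diff_op_sum_single:
  "eval_poly (diff_op (\<Sum>i\<in>A. Poly_Mapping.single (e i) (b i)) f) x =
     (\<Sum>i\<in>A. b i * eval_poly (iter_deriv partial_deriv (e i) f) x)"
proof (induction A rule: infinite_finite_induct)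
  case (insert i A)
  have "eval_poly (diff_op (Poly_Mapping.single (e i) (b i)) f) x =
      b i * eval_poly (iter_deriv partial_deriv (e i) f) x"
    by (subst eval_poly_diff_op_superset[of "{e i}"]) auto
  then show ?case using insert by (simp add: eval_poly_diff_op_add)
qed (simp_all add: eval_poly_diff_op)

definition curve_difference ::
    "nat \<Rightarrow> (nat \<Rightarrow> nat) \<Rightarrow> ('d \<Rightarrow> nat \<Rightarrow> 'a) \<Rightarrow> nat \<Rightarrow> 'a ^ 'd \<Rightarrow> 'a::field_char_0 \<Rightarrow> ('a, 'd::finite) mpoly \<Rightarrow> 'a" where
  "curve_difference n a c m \<xi> h f =
     (\<Sum>s\<le>m. diff_coeff m s / (fact m * h ^ m) * eval_poly f (\<xi> + curve n a c (of_nat s * h)))"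

lemma eval_poly_diff_op_curve_poly:
  fixes c :: "'d::finite \<Rightarrow> nat \<Rightarrow> 'a::field_char_0"
  assumes a: "\<And>j. j \<le> n \<Longrightarrow> 0 < a j" and "m \<le> N"
  defines "I \<equiv> (UNIV :: 'd set) \<times> {0..n}"
  shows "eval_poly (diff_op (curve_poly n a c m) f) \<xi> =
     (\<Sum>\<gamma>\<in>bounded_tuples I N. if (\<Sum>(i, j)\<in>I. a j * \<gamma> (i, j)) = m
        then (\<Prod>(i, j)\<in>I. c i j ^ \<gamma> (i, j) / fact (\<gamma> (i, j))) * eval_poly (multi_deriv (\<lambda>(i, j). axis i 1) \<gamma> I f) \<xi>
        else 0)"
proof -
  have fin: "finite I" by (simp add: I_def)
  have weight: "(\<Sum>(i, j)\<in>I. a j * \<gamma> i j) = (\<Sum>j=0..n. a j * (\<Sum>i\<in>UNIV. \<gamma> i j))" for \<gamma> :: "'d \<Rightarrow> nat \<Rightarrow> nat"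
    unfolding I_def by (subst sum.swap[of _ "{0..n}"] sum.cartesian_product[symmetric])+ (simp add: sum_distrib_left)
  have bound: "\<gamma> i j \<le> N" if "\<gamma> \<in> weighted_tuples n a m" "j \<le> n" for \<gamma> :: "'d \<Rightarrow> nat \<Rightarrow> nat" and i j
  proof -
    have "\<gamma> i j \<le> a j * \<gamma> i j" using a[OF that(2)] by simp
    also have "\<dots> \<le> (\<Sum>(i, j)\<in>I. a j * \<gamma> i j)"
      using that fin by (intro member_le_sum[of "(i, j)" I "\<lambda>(i, j). a j * \<gamma> i j", simplified]) (auto simp: I_def)
    also have "\<dots> \<le> N"
      using that(1) \<open>m \<le> N\<close> by (simp add: weight weighted_tuples_def)
    finally show ?thesis .
  qed
  have coeff: "(\<Prod>i\<in>UNIV. \<Prod>j=0..n. c i j ^ \<gamma> i j) / (\<Prod>i\<in>UNIV. \<Prod>j=0..n. fact (\<gamma> i j)) =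
      (\<Prod>(i, j)\<in>I. c i j ^ \<gamma> i j / fact (\<gamma> i j))" for \<gamma> :: "'d \<Rightarrow> nat \<Rightarrow> nat"
    by (simp add: I_def prod_dividef flip: prod.cartesian_product)
  have deriv: "iter_deriv partial_deriv (\<chi> i. \<Sum>j=0..n. \<gamma> i j) f =
      multi_deriv (\<lambda>(i, j). axis i 1) (\<lambda>(i, j). \<gamma> i j) I f" for \<gamma> :: "'d \<Rightarrow> nat \<Rightarrow> nat"
  proof -
    have "(\<Sum>k | k \<in> I \<and> fst k = i. case k of (i, j) \<Rightarrow> \<gamma> i j) = (\<Sum>j=0..n. \<gamma> i j)" for i
      by (rule sum.reindex_bij_witness[of _ "\<lambda>j. (i, j)" snd]) (auto simp: I_def)
    then have "multi_deriv (\<lambda>k. axis (fst k) 1) (\<lambda>(i, j). \<gamma> i j) I f =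
        multi_deriv (\<lambda>i. axis i 1) (\<lambda>i. \<Sum>j=0..n. \<gamma> i j) UNIV f"
      using multi_deriv_collect[OF fin, of "\<lambda>i. axis i 1" fst "\<lambda>(i, j). \<gamma> i j"] by simp
    then show ?thesis by (simp add: iter_deriv_partial_deriv case_prod_unfold vec_lambda_inverse)
  qed
  have "eval_poly (diff_op (curve_poly n a c m) f) \<xi> =
      (\<Sum>\<gamma>\<in>weighted_tuples n a m. (\<Prod>(i, j)\<in>I. c i j ^ \<gamma> i j / fact (\<gamma> i j)) *
        eval_poly (multi_deriv (\<lambda>(i, j). axis i 1) (\<lambda>(i, j). \<gamma> i j) I f) \<xi>)"
    by (simp add: curve_poly_def eval_poly_diff_op_sum_single coeff deriv)
  also have "\<dots> = (\<Sum>\<gamma>\<in>{\<gamma>\<in>bounded_tuples I N. (\<Sum>(i, j)\<in>I. a j * \<gamma> (i, j)) = m}.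
      (\<Prod>(i, j)\<in>I. c i j ^ \<gamma> (i, j) / fact (\<gamma> (i, j))) * eval_poly (multi_deriv (\<lambda>(i, j). axis i 1) \<gamma> I f) \<xi>)"
  proof (rule sum.reindex_bij_witness[of _ curry case_prod])
    fix \<gamma> :: "'d \<Rightarrow> nat \<Rightarrow> nat" assume \<gamma>: "\<gamma> \<in> weighted_tuples n a m"
    then show "case_prod \<gamma> \<in> {\<gamma>\<in>bounded_tuples I N. (\<Sum>(i, j)\<in>I. a j * \<gamma> (i, j)) = m}"
      using bound[OF \<gamma>] by (auto simp: bounded_tuples_def weight) (auto simp: I_def weighted_tuples_def)
  next
    fix \<gamma> :: "'d \<times> nat \<Rightarrow> nat" assume "\<gamma> \<in> {\<gamma>\<in>bounded_tuples I N. (\<Sum>(i, j)\<in>I. a j * \<gamma> (i, j)) = m}"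
    then show "curry \<gamma> \<in> weighted_tuples n a m"
      using weight[of "curry \<gamma>"] by (auto simp: bounded_tuples_def weighted_tuples_def I_def)
  qed (auto simp: case_prod_beta)
  also have "\<dots> = (\<Sum>\<gamma>\<in>bounded_tuples I N. if (\<Sum>(i, j)\<in>I. a j * \<gamma> (i, j)) = m
        then (\<Prod>(i, j)\<in>I. c i j ^ \<gamma> (i, j) / fact (\<gamma> (i, j))) * eval_poly (multi_deriv (\<lambda>(i, j). axis i 1) \<gamma> I f) \<xi>
        else 0)"
    by (rule sum.inter_filter) (rule finite_bounded_tuples[OF fin])
  finally show ?thesis .
qed

lemma curve_difference_tendsto:
  fixes c :: "'d::finite \<Rightarrow> nat \<Rightarrow> 'a::real_normed_field"
  assumes a: "\<And>j. j \<le> n \<Longrightarrow> 0 < a j"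
  shows "((\<lambda>h. curve_difference n a c m \<xi> h f) \<longlongrightarrow> eval_poly (diff_op (curve_poly n a c m) f) \<xi>) (at 0)"
proof -
  obtain M where "degree_le M f" using ex_degree_le by blast
  define N where "N = M + m"
  have N: "degree_le N f" "m \<le> N"
    using \<open>degree_le M f\<close> by (auto simp: N_def intro: degree_le_mono)
  define I where "I = (UNIV :: 'd set) \<times> {0..n}"
  have fin: "finite I" by (simp add: I_def)
  let ?G = "bounded_tuples I N"
  let ?E = "\<lambda>\<gamma>. eval_poly (multi_deriv (\<lambda>(i, j). axis i 1) \<gamma> I f) \<xi>"
  let ?K = "\<lambda>\<gamma>. \<Prod>(i, j)\<in>I. c i j ^ \<gamma> (i, j) / fact (\<gamma> (i, j))"
  let ?w = "\<lambda>\<gamma>. \<Sum>(i, j)\<in>I. a j * \<gamma> (i, j)"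
  let ?q = "\<lambda>h m r. (\<Sum>s\<le>m. diff_coeff m s * (of_nat s * h) ^ r) / h ^ m"
  have taylor: "eval_poly f (\<xi> + curve n a c t) = (\<Sum>\<gamma>\<in>?G. t ^ ?w \<gamma> * (?K \<gamma> * ?E \<gamma>))" for t
  proof -
    have "curve n a c t = (\<Sum>(i, j)\<in>I. (c i j * t ^ a j) *s axis i 1)"
    proof (subst vec_eq_iff, intro allI)
      fix k
      have "(\<Sum>(i, j)\<in>I. (c i j * t ^ a j) *s axis i 1) $ k =
          (\<Sum>i\<in>UNIV. \<Sum>j=0..n. ((c i j * t ^ a j) *s axis i 1) $ k)"
        by (simp add: I_def sum.cartesian_product case_prod_unfold)
      also have "\<dots> = (\<Sum>i\<in>UNIV. if i = k then \<Sum>j=0..n. c i j * t ^ a j else 0)"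
        by (intro sum.cong refl) (simp add: axis_def)
      finally have "(\<Sum>(i, j)\<in>I. (c i j * t ^ a j) *s axis i 1) $ k =
          (\<Sum>i\<in>UNIV. if i = k then \<Sum>j=0..n. c i j * t ^ a j else 0)" .
      then show "curve n a c t $ k = (\<Sum>(i, j)\<in>I. (c i j * t ^ a j) *s axis i 1) $ k"
        by (simp add: curve_def)
    qed
    then have "curve n a c t = (\<Sum>k\<in>I. (case k of (i, j) \<Rightarrow> c i j * t ^ a j) *s (case k of (i, j) \<Rightarrow> axis i 1))"
      by (simp add: case_prod_beta)
    then have "eval_poly f (\<xi> + curve n a c t) = (\<Sum>\<gamma>\<in>?G.
        (\<Prod>k\<in>I. (case k of (i, j) \<Rightarrow> c i j * t ^ a j) ^ \<gamma> k / fact (\<gamma> k)) * ?E \<gamma>)"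
      by (simp only: taylor_multi[OF fin N(1)])
    also have "\<dots> = (\<Sum>\<gamma>\<in>?G. t ^ ?w \<gamma> * (?K \<gamma> * ?E \<gamma>))"
      by (intro sum.cong refl)
         (simp add: case_prod_beta power_mult_distrib prod.distrib prod_dividef power_sum power_mult flip: mult.assoc)
    finally show ?thesis .
  qed
  have eq: "curve_difference n a c m \<xi> h f = (\<Sum>\<gamma>\<in>?G. ?q h m (?w \<gamma>) / fact m * (?K \<gamma> * ?E \<gamma>))" for h
  proof -
    have "curve_difference n a c m \<xi> h f =
        (\<Sum>\<gamma>\<in>?G. \<Sum>s\<le>m. diff_coeff m s / (fact m * h ^ m) * ((of_nat s * h) ^ ?w \<gamma> * (?K \<gamma> * ?E \<gamma>)))"
      unfolding curve_difference_def taylor sum_distrib_left by (rule sum.swap)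
    also have "\<dots> = (\<Sum>\<gamma>\<in>?G. ?q h m (?w \<gamma>) / fact m * (?K \<gamma> * ?E \<gamma>))"
      by (intro sum.cong refl) (simp add: sum_distrib_left sum_divide_distrib mult_ac)
    finally show ?thesis .
  qed
  have "((\<lambda>h. curve_difference n a c m \<xi> h f) \<longlongrightarrow>
      (\<Sum>\<gamma>\<in>?G. (if ?w \<gamma> = m then fact m else 0) / fact m * (?K \<gamma> * ?E \<gamma>))) (at 0)"
    unfolding eq by (intro tendsto_intros diff_quotient_power_tendsto) auto
  also have "(\<Sum>\<gamma>\<in>?G. (if ?w \<gamma> = m then fact m else 0) / fact m * (?K \<gamma> * ?E \<gamma>)) =
      eval_poly (diff_op (curve_poly n a c m) f) \<xi>"
    unfolding I_def by (subst eval_poly_diff_op_curve_poly[OF a N(2)]) (auto intro!: sum.cong)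
  finally show ?thesis .
qed

subsection \<open>Linear independence of the interpolation conditions\<close>

definition homogeneous_fun :: "nat \<Rightarrow> ('a::comm_semiring_1 ^ 'd::finite \<Rightarrow> 'a) \<Rightarrow> bool" where
  "homogeneous_fun n g \<longleftrightarrow> polynomial_fun g \<and> (\<forall>t v. g (t *s v) = t ^ n * g v)"

lemma polynomial_fun_shift:
  fixes F :: "'a::comm_ring_1 ^ 'd::finite \<Rightarrow> 'a"
  assumes "polynomial_fun F"
  shows "polynomial_fun (\<lambda>x. F (x - \<xi>))"
proof -
  obtain p where "F = eval_poly p" using assms unfolding polynomial_fun_def fun_eq_iff by metis
  then show ?thesis by (auto simp: eval_poly_def intro!: polynomial_fun_intros)
qed

text \<open>The functional \<open>L\<close> behaves at \<open>\<xi>\<close> like a differential operator of order \<open>m\<close> with principal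
  symbol \<open>A\<close>. Here \<open>A\<close> is applied to homogeneous functions of degree \<open>m\<close> only.\<close>

definition has_symbol ::
    "'a::comm_ring_1 ^ 'd::finite \<Rightarrow> nat \<Rightarrow> (('a ^ 'd \<Rightarrow> 'a) \<Rightarrow> 'a) \<Rightarrow> (('a, 'd) mpoly \<Rightarrow> 'a) \<Rightarrow> bool" where
  "has_symbol \<xi> m A L \<longleftrightarrow> (\<forall>n g u f. homogeneous_fun n g \<longrightarrow> polynomial_fun u \<longrightarrow> m \<le> n \<longrightarrow>
     (\<forall>y. eval_poly f y = g (y - \<xi>) * u y) \<longrightarrow> L f = (if n = m then A g * u \<xi> else 0))"

lemma has_symbolD:
  assumes "has_symbol \<xi> m A L" "homogeneous_fun n g" "polynomial_fun u" "m \<le> n"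
    "\<And>y. eval_poly f y = g (y - \<xi>) * u y"
  shows "L f = (if n = m then A g * u \<xi> else 0)"
  using assms by (simp add: has_symbol_def)

lemma scaled_difference_tendsto:
  fixes \<xi> :: "'a::real_normed_field ^ 'd::finite"
  assumes g: "homogeneous_fun n g" and u: "polynomial_fun u"
    and f: "\<And>y. eval_poly f y = g (y - \<xi>) * u y"
    and d: "\<And>s i. s \<in> S \<Longrightarrow> ((\<lambda>h. d h s $ i) \<longlongrightarrow> e s $ i) (at 0)"
    and "m \<le> n"
  shows "((\<lambda>h. \<Sum>s\<in>S. w s / h ^ m * eval_poly f (\<xi> + h *s d h s)) \<longlongrightarrow>
     (if n = m then (\<Sum>s\<in>S. w s * g (e s)) * u \<xi> else 0)) (at 0)"
proof -
  have eq: "(\<Sum>s\<in>S. w s * h ^ (n - m) * g (d h s) * u (\<xi> + h *s d h s)) =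
      (\<Sum>s\<in>S. w s / h ^ m * eval_poly f (\<xi> + h *s d h s))" if "h \<noteq> 0" for h :: 'a
    using g that \<open>m \<le> n\<close> by (intro sum.cong refl) (simp add: f homogeneous_fun_def power_diff)
  have "((\<lambda>h. \<Sum>s\<in>S. w s * h ^ (n - m) * g (d h s) * u (\<xi> + h *s d h s)) \<longlongrightarrow>
      (\<Sum>s\<in>S. w s * 0 ^ (n - m) * g (e s) * u \<xi>)) (at 0)"
  proof (intro tendsto_intros)
    fix s assume s: "s \<in> S"
    show "((\<lambda>h. g (d h s)) \<longlongrightarrow> g (e s)) (at 0)"
      using g d[OF s] by (auto simp: homogeneous_fun_def intro: tendsto_polynomial_fun[rotated])
    show "((\<lambda>h. u (\<xi> + h *s d h s)) \<longlongrightarrow> u \<xi>) (at 0)"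
    proof (rule tendsto_polynomial_fun[OF u])
      fix i
      have "((\<lambda>h. \<xi> $ i + h * d h s $ i) \<longlongrightarrow> \<xi> $ i + 0 * e s $ i) (at 0)"
        by (intro tendsto_intros d[OF s])
      then show "((\<lambda>h. (\<xi> + h *s d h s) $ i) \<longlongrightarrow> \<xi> $ i) (at 0)" by simp
    qed
  qed
  then have "((\<lambda>h. \<Sum>s\<in>S. w s / h ^ m * eval_poly f (\<xi> + h *s d h s)) \<longlongrightarrow>
      (\<Sum>s\<in>S. w s * 0 ^ (n - m) * g (e s) * u \<xi>)) (at 0)"
    by (rule Lim_transform_eventually) (auto simp: eventually_at_filter eq)
  moreover have "(\<Sum>s\<in>S. w s * 0 ^ (n - m) * g (e s) * u \<xi>) = (if n = m then (\<Sum>s\<in>S. w s * g (e s)) * u \<xi> else 0)"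
    using \<open>m \<le> n\<close> by (cases "n = m") (simp_all add: sum_distrib_right zero_power)
  ultimately show ?thesis by simp
qed

lemma has_symbol_grid:
  fixes \<rho> :: "'d::finite \<Rightarrow> 'a::real_normed_field ^ 'd"
  shows "has_symbol \<xi> (\<Sum>i\<in>UNIV. \<alpha> $ i)
     (\<lambda>g. \<Sum>\<beta>\<in>{..\<alpha>}. (\<Prod>i\<in>UNIV. diff_coeff (\<alpha> $ i) (\<beta> $ i)) * g (\<Sum>i\<in>UNIV. of_nat (\<beta> $ i) *s \<rho> i))
     (\<lambda>f. eval_poly (iter_deriv (\<lambda>i. dir_deriv (\<rho> i)) \<alpha> f) \<xi>)"
  unfolding has_symbol_def
proof (intro allI impI)
  fix n :: nat and g u :: "'a ^ 'd \<Rightarrow> 'a" and f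
  assume *: "homogeneous_fun n g" "polynomial_fun u" "(\<Sum>i\<in>UNIV. \<alpha> $ i) \<le> n"
    "\<forall>y. eval_poly f y = g (y - \<xi>) * u y"
  have "((\<lambda>h. grid_difference \<rho> \<alpha> \<xi> h f) \<longlongrightarrow>
      (if n = (\<Sum>i\<in>UNIV. \<alpha> $ i) then (\<Sum>\<beta>\<in>{..\<alpha>}. (\<Prod>i\<in>UNIV. diff_coeff (\<alpha> $ i) (\<beta> $ i)) *
         g (\<Sum>i\<in>UNIV. of_nat (\<beta> $ i) *s \<rho> i)) * u \<xi> else 0)) (at 0)"
    unfolding grid_difference_def prod_dividef power_sum[symmetric]
    using * by (intro scaled_difference_tendsto) auto
  then show "eval_poly (iter_deriv (\<lambda>i. dir_deriv (\<rho> i)) \<alpha> f) \<xi> =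
      (if n = (\<Sum>i\<in>UNIV. \<alpha> $ i) then (\<Sum>\<beta>\<in>{..\<alpha>}. (\<Prod>i\<in>UNIV. diff_coeff (\<alpha> $ i) (\<beta> $ i)) *
         g (\<Sum>i\<in>UNIV. of_nat (\<beta> $ i) *s \<rho> i)) * u \<xi> else 0)"
    by (intro tendsto_unique[OF _ grid_difference_tendsto]) auto
qed

lemma has_symbol_curve:
  fixes c :: "'d::finite \<Rightarrow> nat \<Rightarrow> 'a::real_normed_field"
  assumes a0: "a 0 = 1" and a: "\<And>j. 1 \<le> j \<Longrightarrow> j \<le> n \<Longrightarrow> 2 \<le> a j"
  shows "has_symbol \<xi> m (\<lambda>g. g (\<chi> i. c i 0)) (\<lambda>f. eval_poly (diff_op (curve_poly n a c m) f) \<xi>)"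
  unfolding has_symbol_def
proof (intro allI impI)
  fix k :: nat and g u :: "'a ^ 'd \<Rightarrow> 'a" and f
  assume *: "homogeneous_fun k g" "polynomial_fun u" "m \<le> k" "\<forall>y. eval_poly f y = g (y - \<xi>) * u y"
  have a_pos: "0 < a j" if "j \<le> n" for j
    using a0 a[of j] that by (cases "j = 0") auto
  define d where "d h s = (\<chi> i. \<Sum>j=0..n. c i j * of_nat s ^ a j * h ^ (a j - 1))" for h :: 'a and s :: nat
  have curve_eq: "curve n a c (of_nat s * h) = h *s d h s" for h s
  proof -
    have "c i j * (of_nat s * h) ^ a j = h * (c i j * of_nat s ^ a j * h ^ (a j - 1))" if "j \<le> n" for i j
      using power_Suc[of h "a j - 1"] a_pos[OF that] by (simp add: power_mult_distrib)
    then show ?thesis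
      by (auto simp: curve_def d_def vec_eq_iff sum_distrib_left intro!: sum.cong)
  qed
  have d_lim: "((\<lambda>h. d h s $ i) \<longlongrightarrow> (of_nat s *s (\<chi> i. c i 0)) $ i) (at 0)" for s i
  proof -
    have "((\<lambda>h. \<Sum>j=0..n. c i j * of_nat s ^ a j * h ^ (a j - 1)) \<longlongrightarrow>
        (\<Sum>j=0..n. c i j * of_nat s ^ a j * 0 ^ (a j - 1))) (at 0)"
      by (intro tendsto_intros)
    also have "(\<Sum>j=0..n. c i j * of_nat s ^ a j * 0 ^ (a j - 1)) =
        (\<Sum>j=0..n. if j = 0 then c i 0 * of_nat s else 0)"
    proof (rule sum.cong)
      fix j assume "j \<in> {0..n}"
      then show "c i j * of_nat s ^ a j * 0 ^ (a j - 1) = (if j = 0 then c i 0 * of_nat s else 0)"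
        using a0 a[of j] by (cases "j = 0") (auto simp: zero_power)
    qed simp
    finally show ?thesis by (simp add: d_def mult.commute)
  qed
  have "((\<lambda>h. curve_difference n a c m \<xi> h f) \<longlongrightarrow>
      (if k = m then (\<Sum>s\<le>m. diff_coeff m s / fact m * g (of_nat s *s (\<chi> i. c i 0))) * u \<xi> else 0)) (at 0)"
    unfolding curve_difference_def curve_eq divide_divide_eq_left[symmetric]
    using * d_lim by (intro scaled_difference_tendsto) auto
  then have "eval_poly (diff_op (curve_poly n a c m) f) \<xi> =
      (if k = m then (\<Sum>s\<le>m. diff_coeff m s / fact m * g (of_nat s *s (\<chi> i. c i 0))) * u \<xi> else 0)"
    by (intro tendsto_unique[OF _ curve_difference_tendsto]) (auto intro: a_pos)
  also have "\<dots> = (if k = m then g (\<chi> i. c i 0) * u \<xi> else 0)"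
  proof (cases "k = m")
    case True
    then have "(\<Sum>s\<le>m. diff_coeff m s / fact m * g (of_nat s *s (\<chi> i. c i 0))) =
        (\<Sum>s\<le>m. diff_coeff m s * of_nat s ^ m) / fact m * g (\<chi> i. c i 0)"
      using *(1) by (simp add: homogeneous_fun_def sum_distrib_left sum_divide_distrib mult_ac)
    then show ?thesis by (simp add: sum_diff_coeff_power)
  qed simp
  finally show "eval_poly (diff_op (curve_poly n a c m) f) \<xi> = (if k = m then g (\<chi> i. c i 0) * u \<xi> else 0)" .
qed

lemma dual_coordinates:
  fixes \<rho> :: "'d::finite \<Rightarrow> 'a::field ^ 'd"
  assumes "inj \<rho>" "vec.independent (range \<rho>)"
  obtains u :: "'d \<Rightarrow> 'a ^ 'd" where "\<And>i j. (\<Sum>k\<in>UNIV. u i $ k * \<rho> j $ k) = (if i = j then 1 else 0)"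
proof -
  obtain g where g: "Vector_Spaces.linear (*s) (*s) g" "\<forall>x\<in>range \<rho>. g x = axis (inv \<rho> x) (1::'a)"
    using vec.linear_independent_extend[OF assms(2), of "\<lambda>x. axis (inv \<rho> x) (1::'a) :: 'a ^ 'd"] by blast
  have "(\<Sum>k\<in>UNIV. matrix g $ i $ k * \<rho> j $ k) = (if i = j then 1 else 0)" for i j
  proof -
    have "matrix g *v \<rho> j = axis j 1"
      using matrix_works[OF g(1)] g(2) \<open>inj \<rho>\<close> by simp
    then have "(matrix g *v \<rho> j) $ i = (if i = j then 1 else 0)"
      by (simp add: axis_def)
    then show ?thesis by (simp add: matrix_vector_mult_def)
  qed
  then show ?thesis by (rule that)
qed

lemma homogeneous_fun_power_prod:
  fixes u :: "'i \<Rightarrow> 'a::comm_ring_1 ^ 'd::finite"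
  shows "homogeneous_fun (\<Sum>i\<in>I. \<kappa> i) (\<lambda>v. \<Prod>i\<in>I. (\<Sum>k\<in>UNIV. u i $ k * v $ k) ^ \<kappa> i)"
  unfolding homogeneous_fun_def
proof (intro conjI allI)
  fix t and v :: "'a ^ 'd"
  have "(\<Sum>k\<in>UNIV. u i $ k * (t *s v) $ k) = t * (\<Sum>k\<in>UNIV. u i $ k * v $ k)" for i
    by (simp add: sum_distrib_left mult_ac)
  then show "(\<Prod>i\<in>I. (\<Sum>k\<in>UNIV. u i $ k * (t *s v) $ k) ^ \<kappa> i) =
      t ^ (\<Sum>i\<in>I. \<kappa> i) * (\<Prod>i\<in>I. (\<Sum>k\<in>UNIV. u i $ k * v $ k) ^ \<kappa> i)"
    by (simp add: power_mult_distrib prod.distrib power_sum)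
qed (auto intro!: polynomial_fun_intros)

lemma homogeneous_fun_component_power: "homogeneous_fun n (\<lambda>v::'a::comm_ring_1 ^ 'd::finite. v $ i ^ n)"
  by (auto simp: homogeneous_fun_def power_mult_distrib intro!: polynomial_fun_intros)

lemma grid_symbol_dual:
  fixes \<rho> u :: "'d::finite \<Rightarrow> 'a::field_char_0 ^ 'd"
  assumes u: "\<And>i j. (\<Sum>k\<in>UNIV. u i $ k * \<rho> j $ k) = (if i = j then 1 else 0)"
    and sum_eq: "(\<Sum>i\<in>UNIV. \<kappa> $ i) = (\<Sum>i\<in>UNIV. \<alpha> $ i)"
  shows "(\<Sum>\<beta>\<in>{..\<alpha>}. (\<Prod>i\<in>UNIV. diff_coeff (\<alpha> $ i) (\<beta> $ i)) *
      (\<Prod>i\<in>UNIV. (\<Sum>k\<in>UNIV. u i $ k * (\<Sum>j\<in>UNIV. of_nat (\<beta> $ j) *s \<rho> j) $ k) ^ \<kappa> $ i)) =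
    (if \<kappa> = \<alpha> then \<Prod>i\<in>UNIV. fact (\<alpha> $ i) else 0)"
proof -
  have coord: "(\<Sum>k\<in>UNIV. u i $ k * (\<Sum>j\<in>UNIV. of_nat (\<beta> $ j) *s \<rho> j) $ k) = of_nat (\<beta> $ i)" for i \<beta>
  proof -
    have "(\<Sum>k\<in>UNIV. u i $ k * (\<Sum>j\<in>UNIV. of_nat (\<beta> $ j) *s \<rho> j) $ k) =
        (\<Sum>j\<in>UNIV. of_nat (\<beta> $ j) * (\<Sum>k\<in>UNIV. u i $ k * \<rho> j $ k))"
      by (simp add: sum_distrib_left, subst sum.swap) (simp add: mult_ac)
    then show ?thesis by (simp add: u if_distrib cong: if_cong)
  qed
  have "(\<Sum>\<beta>\<in>{..\<alpha>}. (\<Prod>i\<in>UNIV. diff_coeff (\<alpha> $ i) (\<beta> $ i)) * (\<Prod>i\<in>UNIV. of_nat (\<beta> $ i) ^ \<kappa> $ i)) =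
      (\<Prod>i\<in>UNIV. \<Sum>b\<le>\<alpha> $ i. diff_coeff (\<alpha> $ i) b * (of_nat b :: 'a) ^ \<kappa> $ i)"
    unfolding prod.distrib[symmetric]
    by (rule sum_atMost_vec_prod[of "\<lambda>i b. diff_coeff (\<alpha> $ i) b * of_nat b ^ \<kappa> $ i"])
  also have "\<dots> = (if \<kappa> = \<alpha> then \<Prod>i\<in>UNIV. fact (\<alpha> $ i) else 0)"
  proof (cases "\<kappa> = \<alpha>")
    case True
    then show ?thesis by (simp add: sum_diff_coeff_power)
  next
    case False
    have "\<exists>i. \<kappa> $ i < \<alpha> $ i"
    proof (rule ccontr)
      assume "\<not> ?thesis"
      then have le: "\<alpha> $ i \<le> \<kappa> $ i" for i by (simp add: not_less)
      moreover obtain i where "\<kappa> $ i \<noteq> \<alpha> $ i" using False by (auto simp: vec_eq_iff)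
      ultimately have "(\<Sum>i\<in>UNIV. \<alpha> $ i) < (\<Sum>i\<in>UNIV. \<kappa> $ i)"
        by (intro sum_strict_mono_ex1) (auto simp: le_neq_implies_less intro!: exI[of _ i])
      then show False using sum_eq by simp
    qed
    then obtain i where "\<kappa> $ i < \<alpha> $ i" by blast
    then have "(\<Sum>b\<le>\<alpha> $ i. diff_coeff (\<alpha> $ i) b * (of_nat b :: 'a) ^ \<kappa> $ i) = 0"
      by (simp add: sum_diff_coeff_power)
    then have "(\<Prod>i\<in>UNIV. \<Sum>b\<le>\<alpha> $ i. diff_coeff (\<alpha> $ i) b * (of_nat b :: 'a) ^ \<kappa> $ i) = 0"
      by (intro prod_zero) auto
    then show ?thesis using False by simp
  qed
  finally show ?thesis unfolding coord .
qed

lemma symbols_independent: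
  fixes pt :: "'j \<Rightarrow> 'a::idom ^ 'd::finite"
  assumes "finite J"
    and symbol: "\<And>j. j \<in> J \<Longrightarrow> has_symbol (pt j) (ord j) (A j) (L j)"
    and test: "\<And>j. j \<in> J \<Longrightarrow> \<exists>g. homogeneous_fun (ord j) g \<and> A j g \<noteq> 0 \<and>
      (\<forall>i\<in>J. i \<noteq> j \<longrightarrow> pt i = pt j \<longrightarrow> ord i = ord j \<longrightarrow> A i g = 0)"
    and zero: "\<And>f. (\<Sum>j\<in>J. z j * L j f) = 0"
  shows "\<forall>j\<in>J. z j = 0"
proof (rule ccontr)
  assume nonzero: "\<not> (\<forall>j\<in>J. z j = 0)"
  define J' where "J' = {j\<in>J. z j \<noteq> 0}"
  have J': "finite J'" "J' \<noteq> {}" using \<open>finite J\<close> nonzero by (auto simp: J'_def)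
  have "Max (ord ` J') \<in> ord ` J'" using J' by (intro Max_in) auto
  then obtain j where j: "j \<in> J'" and "ord j = Max (ord ` J')" by auto
  then have j_max: "ord i \<le> ord j" if "i \<in> J'" for i
    using J'(1) that by simp
  have jJ: "j \<in> J" "z j \<noteq> 0" using j by (auto simp: J'_def)
  obtain g where g: "homogeneous_fun (ord j) g" "A j g \<noteq> 0"
    "\<And>i. i \<in> J \<Longrightarrow> i \<noteq> j \<Longrightarrow> pt i = pt j \<Longrightarrow> ord i = ord j \<Longrightarrow> A i g = 0"
    using test[OF jJ(1)] by blast
  define X where "X = pt ` J - {pt j}"
  have X: "finite X" using \<open>finite J\<close> by (simp add: X_def)
  have "\<exists>k. x $ k \<noteq> pt j $ k" if "x \<in> X" for x
    using that by (auto simp: X_def vec_eq_iff)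
  then obtain k where k: "\<And>x. x \<in> X \<Longrightarrow> x $ k x \<noteq> pt j $ k x" by metis
  define u where "u Y y = (\<Prod>x\<in>Y. ((y - x) $ k x) ^ Suc (ord j))" for Y and y :: "'a ^ 'd"
  have poly_u: "polynomial_fun (u Y)" for Y
    unfolding u_def by (auto intro!: polynomial_fun_intros)
  have poly_g: "polynomial_fun (\<lambda>y. g (y - pt j))"
    using g(1) by (auto simp: homogeneous_fun_def intro!: polynomial_fun_shift)
  obtain f where f: "\<And>y. eval_poly f y = g (y - pt j) * u X y"
    using polynomial_fun_mult[OF poly_g poly_u[of X]] unfolding polynomial_fun_def by metis
  have near: "L i f = (if ord j = ord i then A i g * u X (pt j) else 0)" if "i \<in> J'" "pt i = pt j" for i
  proof -
    have "has_symbol (pt j) (ord i) (A i) (L i)" using symbol[of i] that by (simp add: J'_def)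
    then show ?thesis
      by (rule has_symbolD) (rule g(1) poly_u j_max[OF that(1)] f)+
  qed
  have far: "L i f = 0" if i: "i \<in> J'" "pt i \<noteq> pt j" for i
  proof -
    have iX: "pt i \<in> X" using i by (auto simp: X_def J'_def)
    let ?u = "\<lambda>y. g (y - pt j) * u (X - {pt i}) y"
    have "eval_poly f y = ((y - pt i) $ k (pt i)) ^ Suc (ord j) * ?u y" for y
      using X iX by (simp add: f u_def prod.remove[of X "pt i"] mult_ac del: power_Suc vector_minus_component)
    moreover have "polynomial_fun ?u" by (intro polynomial_fun_intros poly_g poly_u)
    moreover have "has_symbol (pt i) (ord i) (A i) (L i)" using symbol[of i] i by (simp add: J'_def)
    ultimately have "L i f = (if Suc (ord j) = ord i then A i (\<lambda>v. v $ k (pt i) ^ Suc (ord j)) * ?u (pt i) else 0)"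
      using homogeneous_fun_component_power[of "Suc (ord j)" "k (pt i)"] j_max[OF i(1)]
      by (intro has_symbolD) auto
    then show ?thesis using j_max[OF i(1)] by auto
  qed
  have other: "z i * L i f = 0" if "i \<in> J - {j}" for i
  proof (cases "i \<in> J'")
    case True
    then show ?thesis using near[OF True] far[OF True] g(3)[of i] that by (cases "pt i = pt j") auto
  qed (use that in \<open>auto simp: J'_def\<close>)
  have "0 = (\<Sum>i\<in>J. z i * L i f)" by (rule zero[symmetric])
  also have "\<dots> = z j * L j f"
    using sum.remove[OF \<open>finite J\<close> jJ(1), of "\<lambda>i. z i * L i f"] sum.neutral[of "J - {j}" "\<lambda>i. z i * L i f"] other by simp
  also have "\<dots> = z j * (A j g * u X (pt j))" using near[OF j] by simp
  finally have "u X (pt j) = 0" using jJ(2) g(2) by simp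
  then obtain x where "x \<in> X" "x $ k x = pt j $ k x"
    using X by (auto simp: u_def)
  then show False using k by blast
qed

subsection \<open>Perturbation of interpolation conditions\<close>

lemma ex_dual_family:
  fixes scale :: "'a::field \<Rightarrow> 'b::ab_group_add \<Rightarrow> 'b"
  assumes "finite J"
    and lin: "\<And>j. j \<in> J \<Longrightarrow> Vector_Spaces.linear scale (*) (\<phi> j)"
    and indep: "\<And>z. (\<And>x. (\<Sum>j\<in>J. z j * \<phi> j x) = 0) \<Longrightarrow> \<forall>j\<in>J. z j = 0"
  shows "\<exists>p. \<forall>i\<in>J. \<forall>j\<in>J. \<phi> i (p j) = (if i = j then 1 else 0)"
  using assms
proof (induction J rule: finite_induct)
  case (insert k J)
  have linear: "\<phi> i (x - y) = \<phi> i x - \<phi> i y" "\<phi> i (scale t x) = t * \<phi> i x"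
      "\<phi> i (sum q J) = (\<Sum>j\<in>J. \<phi> i (q j))" if "i \<in> insert k J" for i x y t q
  proof -
    interpret Vector_Spaces.linear scale "(*)" "\<phi> i" using insert.prems(1) that by blast
    show "\<phi> i (x - y) = \<phi> i x - \<phi> i y" "\<phi> i (scale t x) = t * \<phi> i x"
      "\<phi> i (sum q J) = (\<Sum>j\<in>J. \<phi> i (q j))" by (simp_all add: diff scale sum)
  qed
  have "\<forall>j\<in>J. z j = 0" if "\<And>x. (\<Sum>j\<in>J. z j * \<phi> j x) = 0" for z
  proof -
    have "(\<Sum>j\<in>J. (z(k := 0)) j * \<phi> j x) = (\<Sum>j\<in>J. z j * \<phi> j x)" for x
      using insert.hyps by (intro sum.cong) auto
    then have "(\<Sum>j\<in>insert k J. (z(k := 0)) j * \<phi> j x) = 0" for x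
      using that insert.hyps by simp
    then have "\<forall>j\<in>insert k J. (z(k := 0)) j = 0" by (rule insert.prems(2))
    then show ?thesis using insert.hyps by (auto split: if_splits)
  qed
  then have "\<exists>p. \<forall>i\<in>J. \<forall>j\<in>J. \<phi> i (p j) = (if i = j then 1 else 0)"
    by (intro insert.IH insert.prems(1)) auto
  then obtain p where p: "\<And>i j. i \<in> J \<Longrightarrow> j \<in> J \<Longrightarrow> \<phi> i (p j) = (if i = j then 1 else 0)"
    by blast
  obtain x where x: "\<phi> k x \<noteq> (\<Sum>j\<in>J. \<phi> j x * \<phi> k (p j))"
  proof (rule ccontr)
    assume "\<not> thesis"
    then have eq: "\<phi> k x = (\<Sum>j\<in>J. \<phi> j x * \<phi> k (p j))" for x using that by blast
    let ?z = "\<lambda>j. if j = k then 1 else - \<phi> k (p j)"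
    have "(\<Sum>j\<in>insert k J. ?z j * \<phi> j x) = 0" for x
    proof -
      have "(\<Sum>j\<in>J. ?z j * \<phi> j x) = (\<Sum>j\<in>J. - (\<phi> j x * \<phi> k (p j)))"
        using insert.hyps by (intro sum.cong) auto
      then show ?thesis using insert.hyps by (simp add: sum_negf eq[of x])
    qed
    then have "\<forall>j\<in>insert k J. ?z j = 0" by (rule insert.prems(2))
    then show False by auto
  qed
  define y where "y = x - (\<Sum>j\<in>J. scale (\<phi> j x) (p j))"
  have y_k: "\<phi> k y \<noteq> 0" using x by (simp add: y_def linear)
  have y_J: "\<phi> i y = 0" if "i \<in> J" for i
    using that insert.hyps by (simp add: y_def linear p mult_delta_right)
  define q where "q j = (if j = k then scale (1 / \<phi> k y) y else p j - scale (\<phi> k (p j) / \<phi> k y) y)" for j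
  have "\<phi> i (q j) = (if i = j then 1 else 0)" if "i \<in> insert k J" "j \<in> insert k J" for i j
    using that y_k y_J insert.hyps by (auto simp: q_def linear p)
  then show ?case by blast
qed simp

lemma near_identity_bound:
  fixes M :: "'j \<Rightarrow> 'j \<Rightarrow> 'a::real_normed_field"
  assumes "finite J" "\<And>i j. i \<in> J \<Longrightarrow> j \<in> J \<Longrightarrow> norm (M i j - (if i = j then 1 else 0)) \<le> \<epsilon>"
    and \<epsilon>: "real (card J) * \<epsilon> \<le> 1 / 2"
  shows "(\<Sum>i\<in>J. norm (e i)) \<le> 2 * (\<Sum>i\<in>J. norm (\<Sum>j\<in>J. M i j * e j))"
proof -
  let ?S = "\<Sum>i\<in>J. norm (e i)"
  have "norm (e i) \<le> norm (\<Sum>j\<in>J. M i j * e j) + \<epsilon> * ?S" if "i \<in> J" for i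
  proof -
    have "(\<Sum>j\<in>J. (M i j - (if i = j then 1 else 0)) * e j) =
        (\<Sum>j\<in>J. M i j * e j) - (\<Sum>j\<in>J. if i = j then e j else 0)"
      by (simp add: left_diff_distrib sum_subtractf mult_delta_left)
    also have "\<dots> = (\<Sum>j\<in>J. M i j * e j) - e i" using that \<open>finite J\<close> by simp
    finally have "e i = (\<Sum>j\<in>J. M i j * e j) - (\<Sum>j\<in>J. (M i j - (if i = j then 1 else 0)) * e j)"
      by simp
    then have "norm (e i) \<le> norm (\<Sum>j\<in>J. M i j * e j) + norm (\<Sum>j\<in>J. (M i j - (if i = j then 1 else 0)) * e j)"
      by (metis norm_triangle_ineq4)
    also have "norm (\<Sum>j\<in>J. (M i j - (if i = j then 1 else 0)) * e j) \<le> (\<Sum>j\<in>J. \<epsilon> * norm (e j))"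
      using assms(2) that by (intro sum_norm_le) (simp add: norm_mult mult_right_mono)
    finally show ?thesis by (simp add: sum_distrib_left)
  qed
  then have "?S \<le> (\<Sum>i\<in>J. norm (\<Sum>j\<in>J. M i j * e j) + \<epsilon> * ?S)" by (rule sum_mono)
  also have "\<dots> = (\<Sum>i\<in>J. norm (\<Sum>j\<in>J. M i j * e j)) + real (card J) * \<epsilon> * ?S"
    by (simp add: sum.distrib)
  also have "real (card J) * \<epsilon> * ?S \<le> 1 / 2 * ?S"
    by (intro mult_right_mono \<epsilon> sum_nonneg) simp
  finally show ?thesis by simp
qed

lemma linear_algebraic_dual: "\<phi> \<in> algebraic_dual \<Longrightarrow> Vector_Spaces.linear poly_scale (*) \<phi>"
  by (simp add: algebraic_dual_def)

lemma algebraic_dualI: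
  assumes "\<And>p q. \<phi> (p + q) = \<phi> p + \<phi> q" "\<And>c p. \<phi> (poly_scale c p) = c * \<phi> p"
  shows "\<phi> \<in> algebraic_dual"
  unfolding algebraic_dual_def Vector_Spaces.linear_iff
  using assms by (simp add: mpoly.vector_space_axioms vector_space_over_itself.vector_space_axioms)

context
  fixes \<phi> :: "('a::field, 'd::finite) mpoly \<Rightarrow> 'a"
  assumes \<phi>: "\<phi> \<in> algebraic_dual"
begin

interpretation Vector_Spaces.linear poly_scale "(*)" \<phi>
  by (rule linear_algebraic_dual[OF \<phi>])

lemma dual_add: "\<phi> (p + q) = \<phi> p + \<phi> q" by (rule add)
lemma dual_diff: "\<phi> (p - q) = \<phi> p - \<phi> q" by (rule diff)
lemma dual_scale: "\<phi> (poly_scale c p) = c * \<phi> p" by (rule scale)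
lemma dual_sum: "\<phi> (\<Sum>i\<in>I. f i) = (\<Sum>i\<in>I. \<phi> (f i))" by (rule sum)
lemma dual_zero: "\<phi> 0 = 0" by (rule zero)

end

lemma subspace_algebraic_dual: "functional.subspace algebraic_dual"
  by (rule functional.subspaceI; rule algebraic_dualI)
     (auto simp: dual_add dual_scale functional_scale_def algebra_simps)

lemma eval_poly_in_dual: "(\<lambda>f. eval_poly f x) \<in> algebraic_dual"
  by (rule algebraic_dualI) auto

lemma span_vanishes_iff: "(\<forall>\<phi>\<in>functional.span S. \<phi> p = 0) \<longleftrightarrow> (\<forall>\<phi>\<in>S. \<phi> p = 0)"
proof
  assume S: "\<forall>\<phi>\<in>S. \<phi> p = 0"
  have "functional.subspace {\<phi>. \<phi> p = 0}"
    by (rule functional.subspaceI) (auto simp: functional_scale_def)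
  then have "functional.span S \<subseteq> {\<phi>. \<phi> p = 0}"
    using S by (intro functional.span_minimal) auto
  then show "\<forall>\<phi>\<in>functional.span S. \<phi> p = 0" by blast
qed (auto intro: functional.span_base)

lemma sum_functional_scale_apply:
  "(\<Sum>i\<in>I. functional_scale (w i) (\<phi> i)) f = (\<Sum>i\<in>I. w i * \<phi> i f)"
  by (induction I rule: infinite_finite_induct) (auto simp: functional_scale_def)

lemma linear_combination_in_span:
  assumes "\<And>i. i \<in> I \<Longrightarrow> \<phi> i \<in> functional.span S"
  shows "(\<lambda>f. \<Sum>i\<in>I. w i * \<phi> i f) \<in> functional.span S"
proof -
  have "(\<lambda>f. \<Sum>i\<in>I. w i * \<phi> i f) = (\<Sum>i\<in>I. functional_scale (w i) (\<phi> i))"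
    by (rule ext) (rule sum_functional_scale_apply[symmetric])
  then show ?thesis using assms by (auto intro!: functional.span_sum functional.span_scale)
qed

lemma projector_dual_range_apply:
  assumes "ideal_projector P" "\<phi> \<in> dual_range P"
  shows "\<phi> (P f) = \<phi> f"
proof -
  have "P (P f) = P f" for f using assms(1) by (auto simp: ideal_projector_def fun_eq_iff)
  then show ?thesis using assms(2) by (auto simp: dual_range_def dual_projector_def)
qed

lemma dual_range_subset_dual: "ideal_projector P \<Longrightarrow> dual_range P \<subseteq> algebraic_dual"
  by (auto simp: dual_range_eq_annihilator)

lemma span_eq_of_card:
  assumes "finite J" and indep: "functional.independent (\<psi> ` J)" and inj: "inj_on \<psi> J"
    and sub: "\<psi> ` J \<subseteq> functional.span (\<epsilon> ` J)"
  shows "functional.span (\<psi> ` J) = functional.span (\<epsilon> ` J)"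
proof
  show "functional.span (\<psi> ` J) \<subseteq> functional.span (\<epsilon> ` J)"
    using sub by (rule functional.span_minimal) (rule functional.subspace_span)
  have "\<epsilon> ` J \<subseteq> functional.span (\<psi> ` J)"
  proof (rule ccontr)
    assume "\<not> ?thesis"
    then obtain t where t: "t \<in> \<epsilon> ` J" "t \<notin> functional.span (\<psi> ` J)" by blast
    have "functional.independent (insert t (\<psi> ` J))"
      using t(2) indep by (rule functional.independent_insertI)
    moreover have "insert t (\<psi> ` J) \<subseteq> functional.span (\<epsilon> ` J)"
      using sub t(1) by (auto intro: functional.span_base)
    ultimately have "card (insert t (\<psi> ` J)) \<le> card (\<epsilon> ` J)"
      using functional.independent_span_bound[of "\<epsilon> ` J"] \<open>finite J\<close> by blast
    moreover have "t \<notin> \<psi> ` J" using t(2) functional.span_base[of t "\<psi> ` J"] by blast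
    ultimately have "Suc (card J) \<le> card (\<epsilon> ` J)"
      using \<open>finite J\<close> card_image[OF inj] by simp
    then show False using card_image_le[OF \<open>finite J\<close>, of \<epsilon>] by simp
  qed
  then show "functional.span (\<epsilon> ` J) \<subseteq> functional.span (\<psi> ` J)"
    by (rule functional.span_minimal) (rule functional.subspace_span)
qed

lemma ex_lagrange_projector:
  fixes \<psi> :: "'j \<Rightarrow> ('a::field, 'd::finite) mpoly \<Rightarrow> 'a"
  assumes "finite J"
    and span: "\<And>j. j \<in> J \<Longrightarrow> \<psi> j \<in> functional.span ((\<lambda>j f. eval_poly f (x j)) ` J)"
    and dual: "\<And>i j. i \<in> J \<Longrightarrow> j \<in> J \<Longrightarrow> \<psi> i (q j) = (if i = j then 1 else 0)"
  shows "\<exists>Q. lagrange_projector Q \<and> dual_range Q = functional.span ((\<lambda>j f. eval_poly f (x j)) ` J) \<and>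
    (\<forall>f. Q f = (\<Sum>j\<in>J. poly_scale (\<psi> j f) (q j)))"
proof -
  let ?E = "functional.span ((\<lambda>j f. eval_poly f (x j)) ` J)"
  have "?E \<subseteq> algebraic_dual"
    using eval_poly_in_dual by (intro functional.span_minimal subspace_algebraic_dual) auto
  then have \<psi>_dual: "\<psi> j \<in> algebraic_dual" if "j \<in> J" for j using span[OF that] by blast
  have inj: "inj_on \<psi> J"
  proof (rule inj_onI)
    fix i j assume "i \<in> J" "j \<in> J" "\<psi> i = \<psi> j"
    then show "i = j" using dual[of i j] dual[of j j] by (auto split: if_splits)
  qed
  have indep: "functional.independent (\<psi> ` J)"
  proof (rule functional.independent_if_scalars_zero)
    fix z \<theta> assume z: "(\<Sum>\<phi>\<in>\<psi> ` J. functional_scale (z \<phi>) \<phi>) = 0" and "\<theta> \<in> \<psi> ` J"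
    then obtain j where j: "j \<in> J" "\<theta> = \<psi> j" by blast
    have "0 = (\<Sum>i\<in>J. functional_scale (z (\<psi> i)) (\<psi> i)) (q j)"
      using z inj by (simp add: sum.reindex)
    also have "\<dots> = (\<Sum>i\<in>J. z (\<psi> i) * \<psi> i (q j))"
      by (rule sum_functional_scale_apply)
    also have "\<dots> = z \<theta>" using j \<open>finite J\<close> by (simp add: dual mult_delta_right)
    finally show "z \<theta> = 0" by simp
  qed (use \<open>finite J\<close> in simp)
  have span_eq: "functional.span (\<psi> ` J) = ?E"
    using span by (intro span_eq_of_card \<open>finite J\<close> indep inj) blast
  define Q where "Q f = (\<Sum>j\<in>J. poly_scale (\<psi> j f) (q j))" for f
  have \<psi>_Q: "\<psi> i (Q f) = \<psi> i f" if "i \<in> J" for i f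
    using that \<open>finite J\<close> by (simp add: Q_def dual_sum[OF \<psi>_dual] dual_scale[OF \<psi>_dual] dual mult_delta_right)
  have ker: "poly_kernel Q = {f. \<forall>j\<in>J. \<psi> j f = 0}"
  proof (intro equalityI subsetI)
    fix f assume "f \<in> poly_kernel Q"
    then show "f \<in> {f. \<forall>j\<in>J. \<psi> j f = 0}"
      using \<psi>_Q[of _ f] by (auto simp: poly_kernel_def dual_zero[OF \<psi>_dual])
  next
    fix f assume "f \<in> {f. \<forall>j\<in>J. \<psi> j f = 0}"
    then have "Q f = (\<Sum>j\<in>J. 0)" unfolding Q_def by (intro sum.cong) auto
    then show "f \<in> poly_kernel Q" by (simp add: poly_kernel_def)
  qed
  also have "\<dots> = {f. \<forall>\<phi>\<in>?E. \<phi> f = 0}"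
    unfolding span_eq[symmetric] span_vanishes_iff by auto
  also have "\<dots> = {f. \<forall>y\<in>x ` J. eval_poly f y = 0}"
    unfolding span_vanishes_iff by auto
  finally have ker_eval: "poly_kernel Q = {f. \<forall>y\<in>x ` J. eval_poly f y = 0}" .
  have Q: "ideal_projector Q"
    unfolding ideal_projector_def
  proof (intro conjI)
    show "Vector_Spaces.linear poly_scale poly_scale Q"
      unfolding Vector_Spaces.linear_iff
      by (auto simp: Q_def mpoly.vector_space_axioms dual_add[OF \<psi>_dual] dual_scale[OF \<psi>_dual]
          mpoly.scale_left_distrib sum.distrib mpoly.scale_sum_right intro!: sum.cong)
    show "Q \<circ> Q = Q"
      by (rule ext) (simp add: Q_def[of "Q _"] \<psi>_Q, simp add: Q_def)
    show "\<exists>B. finite B \<and> range Q \<subseteq> mpoly.span B"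
    proof (intro exI conjI)
      have "Q f \<in> mpoly.span (q ` J)" for f
        unfolding Q_def by (intro mpoly.span_sum mpoly.span_scale mpoly.span_base) auto
      then show "range Q \<subseteq> mpoly.span (q ` J)" by blast
    qed (use \<open>finite J\<close> in simp)
    show "is_poly_ideal (poly_kernel Q)"
      unfolding ker_eval is_poly_ideal_def by auto
  qed
  have "dual_range Q = ?E"
  proof (intro equalityI subsetI)
    fix \<phi> assume "\<phi> \<in> dual_range Q"
    then obtain \<theta> where \<theta>: "\<theta> \<in> algebraic_dual" "\<phi> = \<theta> \<circ> Q"
      by (auto simp: dual_range_def dual_projector_def)
    have "\<phi> f = (\<Sum>j\<in>J. \<theta> (q j) * \<psi> j f)" for f
      by (simp add: \<theta>(2) Q_def dual_sum[OF \<theta>(1)] dual_scale[OF \<theta>(1)] mult.commute)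
    then have "\<phi> = (\<lambda>f. \<Sum>j\<in>J. \<theta> (q j) * \<psi> j f)" by (rule ext)
    then show "\<phi> \<in> ?E" using linear_combination_in_span[OF span] by simp
  next
    fix \<phi> assume \<phi>: "\<phi> \<in> ?E"
    then have "\<forall>f\<in>poly_kernel Q. \<phi> f = 0"
      unfolding ker_eval using span_vanishes_iff[of "(\<lambda>j f. eval_poly f (x j)) ` J"] by auto
    then show "\<phi> \<in> dual_range Q"
      using \<phi> \<open>?E \<subseteq> algebraic_dual\<close> by (auto simp: dual_range_eq_annihilator[OF Q])
  qed
  moreover have "lagrange_projector Q"
    unfolding lagrange_projector_def using Q ker_eval \<open>finite J\<close> by (intro conjI exI[of _ "x ` J"]) auto
  ultimately show ?thesis using Q_def by blast
qed

lemma lagrange_projectors_tendsto: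
  fixes L :: "'j \<Rightarrow> ('a::real_normed_field, 'd::finite) mpoly \<Rightarrow> 'a"
    and x :: "'a \<Rightarrow> 'j \<Rightarrow> 'a ^ 'd"
  assumes "finite J" and P: "ideal_projector P" and P_range: "dual_range P = functional.span (L ` J)"
    and indep: "\<And>z. (\<And>f. (\<Sum>j\<in>J. z j * L j f) = 0) \<Longrightarrow> \<forall>j\<in>J. z j = 0"
    and span: "\<And>h j. j \<in> J \<Longrightarrow> \<psi> h j \<in> functional.span ((\<lambda>j f. eval_poly f (x h j)) ` J)"
    and lim: "\<And>j f. j \<in> J \<Longrightarrow> ((\<lambda>h. \<psi> h j f) \<longlongrightarrow> L j f) (at 0)"
  defines "\<Lambda> \<equiv> \<lambda>h. functional.span ((\<lambda>j f. eval_poly f (x h j)) ` J)"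
  shows "\<exists>\<eta>::real. \<eta> > 0 \<and>
     (\<forall>h. 0 < norm h \<and> norm h < \<eta> \<longrightarrow>
        (\<exists>Q. lagrange_projector Q \<and> dual_range Q = \<Lambda> h \<and> range Q = range P)) \<and>
     (\<forall>P\<^sub>h. (\<forall>h. 0 < norm h \<and> norm h < \<eta> \<longrightarrow>
               lagrange_projector (P\<^sub>h h) \<and> dual_range (P\<^sub>h h) = \<Lambda> h \<and> range (P\<^sub>h h) = range P) \<longrightarrow>
        (\<forall>f \<beta>. ((\<lambda>h. Poly_Mapping.lookup (P\<^sub>h h f) \<beta>) \<longlongrightarrow> Poly_Mapping.lookup (P f) \<beta>) (at 0)))"
proof -
  have P_linear: "Vector_Spaces.linear poly_scale poly_scale P" and PP: "P (P f) = P f" for f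
    using P by (auto simp: ideal_projector_def fun_eq_iff)
  interpret P: Vector_Spaces.linear poly_scale poly_scale P by (fact P_linear)
  have L_range: "L j \<in> dual_range P" if "j \<in> J" for j
    unfolding P_range using that by (auto intro: functional.span_base)
  then have L_dual: "L j \<in> algebraic_dual" if "j \<in> J" for j
    using that dual_range_subset_dual[OF P] by blast
  have L_P: "L j (P f) = L j f" if "j \<in> J" for j f
    using projector_dual_range_apply[OF P L_range[OF that]] .
  have "\<Lambda> h \<subseteq> algebraic_dual" for h
    unfolding \<Lambda>_def using eval_poly_in_dual by (intro functional.span_minimal subspace_algebraic_dual) auto
  then have \<psi>_dual: "\<psi> h j \<in> algebraic_dual" if "j \<in> J" for h j
    using span[OF that, of h] unfolding \<Lambda>_def by blast
  have "\<exists>p. \<forall>i\<in>J. \<forall>j\<in>J. L i (p j) = (if i = j then 1 else 0)"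
    by (rule ex_dual_family[OF \<open>finite J\<close> linear_algebraic_dual[OF L_dual] indep])
  then obtain p where p: "\<And>i j. i \<in> J \<Longrightarrow> j \<in> J \<Longrightarrow> L i (p j) = (if i = j then 1 else 0)"
    by blast
  define b where "b j = P (p j)" for j
  have L_b: "L i (b j) = (if i = j then 1 else 0)" if "i \<in> J" "j \<in> J" for i j
    using that by (simp add: b_def L_P p)
  have P_b: "P (b j) = b j" for j by (simp add: b_def PP)
  have P_expand: "P f = (\<Sum>j\<in>J. poly_scale (L j f) (b j))" for f
  proof -
    define r where "r = f - (\<Sum>j\<in>J. poly_scale (L j f) (p j))"
    have "L i r = 0" if "i \<in> J" for i
      using that \<open>finite J\<close>
      by (simp add: r_def dual_diff[OF L_dual] dual_sum[OF L_dual] dual_scale[OF L_dual] p mult_delta_right)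
    then have "\<forall>\<phi>\<in>dual_range P. \<phi> r = 0" unfolding P_range span_vanishes_iff by auto
    then have "r \<in> poly_kernel P" by (subst poly_kernel_eq_dual_range) simp
    then have "P r = 0" by (simp add: poly_kernel_def)
    then show ?thesis by (simp add: r_def P.diff P.sum P.scale b_def)
  qed
  have range_expand: "v = (\<Sum>j\<in>J. poly_scale (L j v) (b j))" if "v \<in> range P" for v
    using that P_expand[of v] PP by auto
  have \<psi>_expand: "\<psi> h i v = (\<Sum>j\<in>J. \<psi> h i (b j) * L j v)" if "i \<in> J" "v \<in> range P" for h i v
    using that(1) by (subst range_expand[OF that(2)])
      (simp add: dual_sum[OF \<psi>_dual] dual_scale[OF \<psi>_dual] mult.commute)
  define \<epsilon> where "\<epsilon> = 1 / (2 * (real (card J) + 1))"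
  have \<epsilon>: "\<epsilon> > 0" "real (card J) * \<epsilon> \<le> 1 / 2" by (auto simp: \<epsilon>_def field_simps)
  have "\<forall>\<^sub>F h in at 0. \<forall>i\<in>J. \<forall>j\<in>J. dist (\<psi> h i (b j)) (if i = j then 1 else 0) < \<epsilon>"
    using lim \<epsilon>(1) \<open>finite J\<close>
    by (intro eventually_ball_finite ballI) (auto dest!: tendstoD simp flip: L_b)
  then obtain \<eta> where \<eta>: "\<eta> > 0" "\<And>h i j. 0 < norm h \<Longrightarrow> norm h < \<eta> \<Longrightarrow> i \<in> J \<Longrightarrow> j \<in> J \<Longrightarrow>
      norm (\<psi> h i (b j) - (if i = j then 1 else 0)) < \<epsilon>"
    unfolding eventually_at by (auto simp: dist_norm)
  have bound: "(\<Sum>i\<in>J. norm (e i)) \<le> 2 * (\<Sum>i\<in>J. norm (\<Sum>j\<in>J. \<psi> h i (b j) * e j))"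
    if "0 < norm h" "norm h < \<eta>" for h e
    by (rule near_identity_bound[OF \<open>finite J\<close> less_imp_le[OF \<eta>(2)[OF that]] \<epsilon>(2)])
  have exists: "\<exists>Q. lagrange_projector Q \<and> dual_range Q = \<Lambda> h \<and> range Q = range P"
    if h: "0 < norm h" "norm h < \<eta>" for h
  proof -
    have indep_P: "\<forall>j\<in>J. z j = 0" if z: "\<And>f. (\<Sum>i\<in>J. z i * \<psi> h i (P f)) = 0" for z
    proof -
      have "(\<Sum>i\<in>J. norm (z i)) \<le> 2 * (\<Sum>j\<in>J. norm (\<Sum>i\<in>J. \<psi> h i (b j) * z i))"
      proof (rule near_identity_bound[OF \<open>finite J\<close> _ \<epsilon>(2)])
        show "norm (\<psi> h i (b j) - (if j = i then 1 else 0)) \<le> \<epsilon>" if "j \<in> J" "i \<in> J" for i j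
          using \<eta>(2)[OF h that(2,1)] by (cases "i = j") auto
      qed
      also have "\<dots> = 0" using z[of "b _"] by (simp add: P_b mult.commute)
      finally have "(\<Sum>i\<in>J. norm (z i)) = 0" by (simp add: sum_nonneg order_antisym)
      then show ?thesis using \<open>finite J\<close> by (simp add: sum_nonneg_eq_0_iff)
    qed
    have linear_P: "Vector_Spaces.linear poly_scale (*) (\<lambda>f. \<psi> h j (P f))" if "j \<in> J" for j
      using Vector_Spaces.linear_compose[OF P_linear linear_algebraic_dual[OF \<psi>_dual[OF that]]]
      by (simp add: comp_def)
    have "\<exists>q. \<forall>i\<in>J. \<forall>j\<in>J. \<psi> h i (P (q j)) = (if i = j then 1 else 0)"
      by (rule ex_dual_family[OF \<open>finite J\<close> linear_P indep_P])
    then obtain q where q: "\<And>i j. i \<in> J \<Longrightarrow> j \<in> J \<Longrightarrow> \<psi> h i (P (q j)) = (if i = j then 1 else 0)"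
      by blast
    obtain Q where Q: "lagrange_projector Q" "dual_range Q = \<Lambda> h"
      "\<And>f. Q f = (\<Sum>j\<in>J. poly_scale (\<psi> h j f) (P (q j)))"
      using ex_lagrange_projector[OF \<open>finite J\<close>, of "\<psi> h" "x h" "\<lambda>j. P (q j)"] span q
      unfolding \<Lambda>_def by blast
    have Q_P: "Q f = P (\<Sum>j\<in>J. poly_scale (\<psi> h j f) (q j))" for f
      by (simp add: Q(3) P.sum P.scale)
    have Q_proj: "ideal_projector Q" using Q(1) by (simp add: lagrange_projector_def)
    have "v \<in> range Q" if v: "v \<in> range P" for v
    proof -
      obtain f where "v = P f" using v by blast
      then have "v - Q v = P (f - (\<Sum>j\<in>J. poly_scale (\<psi> h j v) (q j)))"
        unfolding Q_P[of v] by (simp add: P.diff)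
      then have w: "v - Q v \<in> range P" by blast
      have "\<psi> h i (v - Q v) = 0" if "i \<in> J" for i
        using projector_dual_range_apply[OF Q_proj, of "\<psi> h i"] span[OF that] Q(2)
        by (simp add: dual_diff[OF \<psi>_dual[OF that]] \<Lambda>_def)
      then have "(\<Sum>i\<in>J. norm (\<Sum>j\<in>J. \<psi> h i (b j) * L j (v - Q v))) = 0"
        using \<psi>_expand[OF _ w] by simp
      then have "(\<Sum>j\<in>J. norm (L j (v - Q v))) = 0"
        using bound[OF h, of "\<lambda>j. L j (v - Q v)"] by (simp add: sum_nonneg order_antisym)
      then have "\<And>j. j \<in> J \<Longrightarrow> L j (v - Q v) = 0"
        using \<open>finite J\<close> by (simp add: sum_nonneg_eq_0_iff)
      then have "v - Q v = 0" using range_expand[OF w] by simp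
      then show ?thesis by (metis eq_iff_diff_eq_0 rangeI)
    qed
    moreover have "range Q \<subseteq> range P" using Q_P by auto
    ultimately show ?thesis using Q by blast
  qed
  have limit: "((\<lambda>h. Poly_Mapping.lookup (R h f) \<beta>) \<longlongrightarrow> Poly_Mapping.lookup (P f) \<beta>) (at 0)"
    if R: "\<And>h. 0 < norm h \<Longrightarrow> norm h < \<eta> \<Longrightarrow>
        lagrange_projector (R h) \<and> dual_range (R h) = \<Lambda> h \<and> range (R h) = range P" for R f \<beta>
  proof -
    have near: "\<forall>\<^sub>F h::'a in at 0. 0 < norm h \<and> norm h < \<eta>"
      unfolding eventually_at using \<eta>(1) by (intro exI[of _ \<eta>]) (auto simp: dist_norm)
    define B where "B h = 2 * (\<Sum>i\<in>J. norm (\<psi> h i f - (\<Sum>j\<in>J. \<psi> h i (b j) * L j f)))" for h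
    have "(B \<longlongrightarrow> 2 * (\<Sum>i\<in>J. norm (L i f - (\<Sum>j\<in>J. L i (b j) * L j f)))) (at 0)"
      unfolding B_def by (intro tendsto_intros lim)
    moreover have "(\<Sum>i\<in>J. norm (L i f - (\<Sum>j\<in>J. L i (b j) * L j f))) = 0"
      using \<open>finite J\<close> by (intro sum.neutral) (simp add: L_b mult_delta_left)
    ultimately have B: "(B \<longlongrightarrow> 0) (at 0)" by simp
    have close: "norm (L j (R h f) - L j f) \<le> B h" if h: "0 < norm h" "norm h < \<eta>" and "j \<in> J" for h j
    proof -
      have Rh: "ideal_projector (R h)" "dual_range (R h) = \<Lambda> h" "R h f \<in> range P"
        using R[OF h] by (auto simp: lagrange_projector_def)
      have "(\<Sum>j\<in>J. \<psi> h i (b j) * L j (R h f)) = \<psi> h i f" if "i \<in> J" for i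
        using projector_dual_range_apply[OF Rh(1), of "\<psi> h i"] span[OF that] Rh(2)
        by (simp add: \<Lambda>_def flip: \<psi>_expand[OF that Rh(3)])
      then have "(\<Sum>j\<in>J. norm (L j (R h f) - L j f)) \<le> B h"
        using bound[OF h, of "\<lambda>j. L j (R h f) - L j f"]
        by (simp add: B_def right_diff_distrib sum_subtractf)
      moreover have "norm (L j (R h f) - L j f) \<le> (\<Sum>j\<in>J. norm (L j (R h f) - L j f))"
        using \<open>j \<in> J\<close> \<open>finite J\<close> by (intro member_le_sum) auto
      ultimately show ?thesis by linarith
    qed
    have L_lim: "((\<lambda>h. L j (R h f)) \<longlongrightarrow> L j f) (at 0)" if "j \<in> J" for j
    proof (rule LIM_zero_cancel, rule Lim_null_comparison[OF _ B])
      show "\<forall>\<^sub>F h in at 0. norm (L j (R h f) - L j f) \<le> B h"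
        using near by (rule eventually_mono) (use close that in blast)
    qed
    have "((\<lambda>h. \<Sum>j\<in>J. L j (R h f) * Poly_Mapping.lookup (b j) \<beta>) \<longlongrightarrow>
        (\<Sum>j\<in>J. L j f * Poly_Mapping.lookup (b j) \<beta>)) (at 0)"
      by (intro tendsto_intros L_lim)
    also have "(\<Sum>j\<in>J. L j f * Poly_Mapping.lookup (b j) \<beta>) = Poly_Mapping.lookup (P f) \<beta>"
      by (subst P_expand[of f]) (simp add: lookup_sum)
    finally have lookup_lim: "((\<lambda>h. \<Sum>j\<in>J. L j (R h f) * Poly_Mapping.lookup (b j) \<beta>) \<longlongrightarrow>
        Poly_Mapping.lookup (P f) \<beta>) (at 0)" .
    have expand: "(\<Sum>j\<in>J. L j (R h f) * Poly_Mapping.lookup (b j) \<beta>) = Poly_Mapping.lookup (R h f) \<beta>"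
      if "0 < norm h" "norm h < \<eta>" for h
    proof -
      have "R h f \<in> range P" using R[OF that] by auto
      from arg_cong[OF range_expand[OF this], of "\<lambda>g. Poly_Mapping.lookup g \<beta>"]
      show ?thesis by (simp add: lookup_sum)
    qed
    have "\<forall>\<^sub>F h in at 0. (\<Sum>j\<in>J. L j (R h f) * Poly_Mapping.lookup (b j) \<beta>) = Poly_Mapping.lookup (R h f) \<beta>"
      using near by (rule eventually_mono) (use expand in blast)
    with lookup_lim show ?thesis by (rule Lim_transform_eventually)
  qed
  show ?thesis
  proof (rule exI[of _ \<eta>], intro conjI allI impI)
    show "\<eta> > 0" by (rule \<eta>(1))
  next
    fix h :: 'a assume "0 < norm h \<and> norm h < \<eta>"
    then show "\<exists>Q. lagrange_projector Q \<and> dual_range Q = \<Lambda> h \<and> range Q = range P"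
      by (intro exists) auto
  next
    fix R f \<beta>
    assume "\<forall>h. 0 < norm h \<and> norm h < \<eta> \<longrightarrow>
      lagrange_projector (R h) \<and> dual_range (R h) = \<Lambda> h \<and> range (R h) = range P"
    then show "((\<lambda>h. Poly_Mapping.lookup (R h f) \<beta>) \<longlongrightarrow> Poly_Mapping.lookup (P f) \<beta>) (at 0)"
      by (intro limit) blast
  qed
qed

subsection \<open>Convergence of the Lagrange projectors\<close>

lemma image_case_sum_Sigma:
  "case_sum (\<lambda>(k, \<alpha>). F k \<alpha>) (\<lambda>(l, m). G l m) ` (Sigma A B <+> Sigma C D) =
     {F k \<alpha> | k \<alpha>. k \<in> A \<and> \<alpha> \<in> B k} \<union> {G l m | l m. l \<in> C \<and> m \<in> D l}"
  by (force simp: Plus_def image_Un image_image)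

theorem theorem7:
  fixes \<mu> \<nu> :: nat
    and \<xi> :: "nat \<Rightarrow> 'a::real_normed_field ^ 'd::finite"
    and \<Delta> :: "nat \<Rightarrow> (nat ^ 'd) set"
    and \<rho> :: "nat \<Rightarrow> 'd \<Rightarrow> 'a ^ 'd"
    and n :: "nat \<Rightarrow> nat"
    and a :: "nat \<Rightarrow> nat \<Rightarrow> nat"
    and c :: "nat \<Rightarrow> 'd \<Rightarrow> nat \<Rightarrow> 'a"
    and P :: "('a, 'd) mpoly \<Rightarrow> ('a, 'd) mpoly"
    and \<Lambda> :: "'a \<Rightarrow> (('a, 'd) mpoly \<Rightarrow> 'a) set"
  assumes distinct_points: "inj_on \<xi> {1..\<mu> + \<nu>}"
    and Delta: "\<And>k. k \<in> {1..\<mu>} \<Longrightarrow> finite (\<Delta> k) \<and> is_lower_set (\<Delta> k)"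
    and rho_unit: "\<And>k i. k \<in> {1..\<mu>} \<Longrightarrow> norm (\<rho> k i) = 1"
    and rho_indep: "\<And>k. k \<in> {1..\<mu>} \<Longrightarrow> inj (\<rho> k) \<and> vec.independent (range (\<rho> k))"
    and n_ge: "\<And>l. l \<in> {1..\<nu>} \<Longrightarrow> n l \<ge> 1"
    and a_0: "\<And>l. l \<in> {1..\<nu>} \<Longrightarrow> a l 0 = 1"
    and a_decreasing: "\<And>l i j. l \<in> {1..\<nu>} \<Longrightarrow> 1 \<le> i \<Longrightarrow> i < j \<Longrightarrow> j \<le> n l \<Longrightarrow> a l i > a l j"
    and a_last: "\<And>l. l \<in> {1..\<nu>} \<Longrightarrow> a l (n l) \<ge> 2"
    and c_nonzero: "\<And>l. l \<in> {1..\<nu>} \<Longrightarrow> \<exists>i. c l i 0 \<noteq> 0"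
    and P_proj: "ideal_projector P"
    and P_conditions: "dual_range P = functional.span
       ({(\<lambda>f. eval_poly (iter_deriv (\<lambda>i. dir_deriv (\<rho> k i)) \<alpha> f) (\<xi> k)) | k \<alpha>.
           k \<in> {1..\<mu>} \<and> \<alpha> \<in> \<Delta> k} \<union>
        {(\<lambda>f. eval_poly (diff_op (curve_poly (n l) (a l) (c l) m) f) (\<xi> (\<mu> + l))) | l m.
           l \<in> {1..\<nu>} \<and> m \<le> a l 1})"
    and Lambda: "\<And>h. \<Lambda> h = functional.span
       ({(\<lambda>f. eval_poly f (\<xi> k + h *s (\<Sum>i\<in>UNIV. of_nat (\<alpha> $ i) *s \<rho> k i))) | k \<alpha>.
           k \<in> {1..\<mu>} \<and> \<alpha> \<in> \<Delta> k} \<union>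
        {(\<lambda>f. eval_poly f (\<xi> (\<mu> + l) + curve (n l) (a l) (c l) (of_nat m * h))) | l m.
           l \<in> {1..\<nu>} \<and> m \<le> a l 1})"
  shows "\<exists>\<eta>::real. \<eta> > 0 \<and>
     (\<forall>h. 0 < norm h \<and> norm h < \<eta> \<longrightarrow>
        (\<exists>Q. lagrange_projector Q \<and> dual_range Q = \<Lambda> h \<and> range Q = range P)) \<and>
     (\<forall>P\<^sub>h. (\<forall>h. 0 < norm h \<and> norm h < \<eta> \<longrightarrow>
               lagrange_projector (P\<^sub>h h) \<and> dual_range (P\<^sub>h h) = \<Lambda> h \<and> range (P\<^sub>h h) = range P) \<longrightarrow>
        (\<forall>f \<beta>. ((\<lambda>h. Poly_Mapping.lookup (P\<^sub>h h f) \<beta>) \<longlongrightarrow> Poly_Mapping.lookup (P f) \<beta>) (at 0)))"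
proof -
  define J where "J = (SIGMA k:{1..\<mu>}. \<Delta> k) <+> (SIGMA l:{1..\<nu>}. {..a l 1})"
  define L where "L = case_sum
      (\<lambda>(k, \<alpha>) f. eval_poly (iter_deriv (\<lambda>i. dir_deriv (\<rho> k i)) \<alpha> f) (\<xi> k))
      (\<lambda>(l, m) f. eval_poly (diff_op (curve_poly (n l) (a l) (c l) m) f) (\<xi> (\<mu> + l)))"
  define \<psi> where "\<psi> h = case_sum
      (\<lambda>(k, \<alpha>). grid_difference (\<rho> k) \<alpha> (\<xi> k) h)
      (\<lambda>(l, m). curve_difference (n l) (a l) (c l) m (\<xi> (\<mu> + l)) h)" for h
  define x where "x h = case_sum
      (\<lambda>(k, \<alpha>). \<xi> k + h *s (\<Sum>i\<in>UNIV. of_nat (\<alpha> $ i) *s \<rho> k i))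
      (\<lambda>(l, m). \<xi> (\<mu> + l) + curve (n l) (a l) (c l) (of_nat m * h))" for h
  have x_Inl: "x h (Inl (k, \<alpha>)) = \<xi> k + h *s (\<Sum>i\<in>UNIV. of_nat (\<alpha> $ i) *s \<rho> k i)"
    and x_Inr: "x h (Inr (l, m)) = \<xi> (\<mu> + l) + curve (n l) (a l) (c l) (of_nat m * h)" for h k \<alpha> l m
    by (simp_all add: x_def)
  define pt where "pt = case_sum (\<lambda>(k, \<alpha> :: nat ^ 'd). \<xi> k) (\<lambda>(l, m :: nat). \<xi> (\<mu> + l))"
  define ord where "ord = case_sum (\<lambda>(k :: nat, \<alpha> :: nat ^ 'd). \<Sum>i\<in>UNIV. \<alpha> $ i) (\<lambda>(l :: nat, m). m)"
  define A where "A = case_sum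
      (\<lambda>(k, \<alpha>) g. \<Sum>\<beta>\<in>{..\<alpha>}. (\<Prod>i\<in>UNIV. diff_coeff (\<alpha> $ i) (\<beta> $ i)) *
         g (\<Sum>i\<in>UNIV. of_nat (\<beta> $ i) *s \<rho> k i))
      (\<lambda>(l, m :: nat) g. g (\<chi> i. c l i 0) :: 'a)"
  have a_ge: "2 \<le> a l j" if "l \<in> {1..\<nu>}" "1 \<le> j" "j \<le> n l" for l j
    using a_last[OF that(1)] a_decreasing[OF that(1,2), of "n l"] that(3) by (cases "j = n l") auto
  have a_pos: "0 < a l j" if "l \<in> {1..\<nu>}" "j \<le> n l" for l j
    using a_0[OF that(1)] a_ge[OF that(1), of j] that(2) by (cases "j = 0") auto
  have "finite J"
    using Delta by (auto simp: J_def intro!: finite_Plus finite_SigmaI)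
  have E_image: "(\<lambda>j f. eval_poly f (x h j)) ` J =
      {(\<lambda>f. eval_poly f (\<xi> k + h *s (\<Sum>i\<in>UNIV. of_nat (\<alpha> $ i) *s \<rho> k i))) | k \<alpha>.
           k \<in> {1..\<mu>} \<and> \<alpha> \<in> \<Delta> k} \<union>
      {(\<lambda>f. eval_poly f (\<xi> (\<mu> + l) + curve (n l) (a l) (c l) (of_nat m * h))) | l m.
           l \<in> {1..\<nu>} \<and> m \<le> a l 1}" for h
  proof -
    have "(\<lambda>j f. eval_poly f (x h j)) = case_sum
        (\<lambda>(k, \<alpha>) f. eval_poly f (\<xi> k + h *s (\<Sum>i\<in>UNIV. of_nat (\<alpha> $ i) *s \<rho> k i)))
        (\<lambda>(l, m) f. eval_poly f (\<xi> (\<mu> + l) + curve (n l) (a l) (c l) (of_nat m * h)))"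
      by (auto simp: x_def fun_eq_iff split: sum.split)
    then show ?thesis by (simp only: J_def image_case_sum_Sigma atMost_iff)
  qed
  have L_image: "dual_range P = functional.span (L ` J)"
    unfolding P_conditions L_def J_def image_case_sum_Sigma atMost_iff ..
  have span: "\<psi> h j \<in> functional.span ((\<lambda>j f. eval_poly f (x h j)) ` J)" if "j \<in> J" for h j
  proof -
    have E: "(\<lambda>f. eval_poly f (x h i)) \<in> functional.span ((\<lambda>j f. eval_poly f (x h j)) ` J)" if "i \<in> J" for i
      using that by (intro functional.span_base) blast
    show ?thesis
    proof (cases j)
      case (Inl p)
      then obtain k \<alpha> where j: "j = Inl (k, \<alpha>)" by (cases p) auto
      then have k: "k \<in> {1..\<mu>}" "\<alpha> \<in> \<Delta> k" using \<open>j \<in> J\<close> by (auto simp: J_def)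
      have "Inl (k, \<beta>) \<in> J" if "\<beta> \<le> \<alpha>" for \<beta>
        using Delta[OF k(1)] k that by (auto simp: J_def is_lower_set_def)
      then have "(\<lambda>f. \<Sum>\<beta>\<in>{..\<alpha>}. (\<Prod>i\<in>UNIV. diff_coeff (\<alpha> $ i) (\<beta> $ i) / h ^ (\<alpha> $ i)) *
          eval_poly f (x h (Inl (k, \<beta>)))) \<in> functional.span ((\<lambda>j f. eval_poly f (x h j)) ` J)"
        by (intro linear_combination_in_span E) simp
      then show ?thesis
        by (simp add: j \<psi>_def grid_difference_def[abs_def] x_Inl)
    next
      case (Inr p)
      then obtain l m where j: "j = Inr (l, m)" by (cases p) auto
      then have "Inr (l, s) \<in> J" if "s \<le> m" for s using \<open>j \<in> J\<close> that by (auto simp: J_def)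
      then have "(\<lambda>f. \<Sum>s\<le>m. diff_coeff m s / (fact m * h ^ m) *
          eval_poly f (x h (Inr (l, s)))) \<in> functional.span ((\<lambda>j f. eval_poly f (x h j)) ` J)"
        by (intro linear_combination_in_span E) simp
      then show ?thesis
        by (simp add: j \<psi>_def curve_difference_def[abs_def] x_Inr)
    qed
  qed
  have lim: "((\<lambda>h. \<psi> h j f) \<longlongrightarrow> L j f) (at 0)" if "j \<in> J" for j f
    using that a_pos
    by (auto simp: J_def \<psi>_def L_def intro!: grid_difference_tendsto curve_difference_tendsto)
  have symbol: "has_symbol (pt j) (ord j) (A j) (L j)" if "j \<in> J" for j
    using that a_0 a_ge
    by (auto simp: J_def pt_def ord_def A_def L_def intro!: has_symbol_grid has_symbol_curve)
  have \<xi>_eq: "\<xi> i = \<xi> j \<longleftrightarrow> i = j" if "i \<in> {1..\<mu> + \<nu>}" "j \<in> {1..\<mu> + \<nu>}" for i j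
    using distinct_points that by (rule inj_on_eq_iff)
  have test: "\<exists>g. homogeneous_fun (ord j) g \<and> A j g \<noteq> 0 \<and>
      (\<forall>i\<in>J. i \<noteq> j \<longrightarrow> pt i = pt j \<longrightarrow> ord i = ord j \<longrightarrow> A i g = 0)" if "j \<in> J" for j
  proof (cases j)
    case (Inl p)
    then obtain k \<alpha> where j: "j = Inl (k, \<alpha>)" by (cases p) auto
    then have k: "k \<in> {1..\<mu>}" using \<open>j \<in> J\<close> by (auto simp: J_def)
    obtain u :: "'d \<Rightarrow> 'a ^ 'd" where u: "\<And>i j. (\<Sum>r\<in>UNIV. u i $ r * \<rho> k j $ r) = (if i = j then 1 else 0)"
      using dual_coordinates rho_indep[OF k] by metis
    define g where "g v = (\<Prod>i\<in>UNIV. (\<Sum>r\<in>UNIV. u i $ r * v $ r) ^ (\<alpha> $ i))" for v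
    have A_g: "A (Inl (k, \<beta>)) g = (if \<alpha> = \<beta> then \<Prod>i\<in>UNIV. fact (\<beta> $ i) else 0)"
      if "(\<Sum>i\<in>UNIV. \<beta> $ i) = (\<Sum>i\<in>UNIV. \<alpha> $ i)" for \<beta>
      using grid_symbol_dual[OF u, of \<alpha> \<beta>] that by (simp add: A_def g_def)
    show ?thesis
    proof (intro exI[of _ g] conjI ballI impI)
      show "homogeneous_fun (ord j) g"
        unfolding j ord_def g_def by (simp add: homogeneous_fun_power_prod)
      show "A j g \<noteq> 0" using A_g[of \<alpha>] by (simp add: j)
    next
      fix i assume i: "i \<in> J" "i \<noteq> j" "pt i = pt j" "ord i = ord j"
      then obtain \<beta> where "i = Inl (k, \<beta>)"
        using k by (auto simp: J_def j pt_def \<xi>_eq)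
      then show "A i g = 0" using i A_g[of \<beta>] by (auto simp: j ord_def)
    qed
  next
    case (Inr p)
    then obtain l m where j: "j = Inr (l, m)" by (cases p) auto
    then have l: "l \<in> {1..\<nu>}" using \<open>j \<in> J\<close> by (auto simp: J_def)
    obtain r where r: "c l r 0 \<noteq> 0" using c_nonzero[OF l] by blast
    show ?thesis
    proof (intro exI[of _ "\<lambda>v :: 'a ^ 'd. v $ r ^ m"] conjI ballI impI)
      show "homogeneous_fun (ord j) (\<lambda>v :: 'a ^ 'd. v $ r ^ m)"
        by (simp add: j ord_def homogeneous_fun_component_power)
      show "A j (\<lambda>v :: 'a ^ 'd. v $ r ^ m) \<noteq> 0" using r by (simp add: j A_def)
    next
      fix i assume i: "i \<in> J" "i \<noteq> j" "pt i = pt j" "ord i = ord j"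
      then have False using l by (auto simp: J_def j pt_def ord_def \<xi>_eq)
      then show "A i (\<lambda>v :: 'a ^ 'd. v $ r ^ m) = 0" ..
    qed
  qed
  have indep: "\<forall>j\<in>J. z j = 0" if "\<And>f. (\<Sum>j\<in>J. z j * L j f) = 0" for z
    using \<open>finite J\<close> symbol test that by (rule symbols_independent)
  show ?thesis
    unfolding Lambda E_image[symmetric]
    by (rule lagrange_projectors_tendsto[OF \<open>finite J\<close> P_proj L_image indep span lim])
qed

end
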